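(* Let $\alpha\in(0,2]$ and let $f$ be the probability density of an $S\alpha S$ law in $\mathbb{R}^d$ with associated star body $F$. Then, for each unit vector $u\in\mathbb{R}^d$, $$\int_{\mathbb{R}}f(tu)\,dt=\frac{1}{(2\pi)^{d-1}}\,\Gamma\Big(1+\frac{d-1}{\alpha}\Big)\,A_{F,u},$$ where $A_{F,u}=\mathrm{Vol}_{d-1}(F\cap u^\perp)$ is the $(d-1)$-dimensional Lebesgue measure of the intersection of $F$ with the subspace $u^\perp$ orthogonal to $u$.
   Context: A random vector $\xi\in\mathbb{R}^d$ is symmetric $\alpha$-stable ($S\alpha S$), $\alpha\in(0,2]$, if $\xi$ has the same distribution as $-\xi$ and $a^{1/\alpha}\xi_1+b^{1/\alpha}\xi_2$ has the same distribution as $(a+b)^{1/\alpha}\xi$ for all $a,b>0$, where $\xi_1,\xi_2$ are independent copies of $\xi$. Its characteristic function can be written as $\mathbf{E}e^{i\langle\xi,u\rangle}=e^{-\|u\|_F^\alpha}$ with $\|u\|_F^\alpha=\int_{\mathbb{S}^{d-1}}|\langle u,z\rangle|^\alpha\sigma(dz)$ for a symmetric finite measure $\sigma$ (the spectral measure) on the Euclidean unit sphere $\mathbb{S}^{d-1}$; the set $F=\{u:\|u\|_F\le1\}$ is the associated star body of $\xi$. The law has a density precisely when $\sigma$ is not concentrated on the intersection of $\mathbb{S}^{d-1}$ with a $(d-1)$-dimensional subspace; $f$ denotes its continuous version. *)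

theory Defs
  imports "HOL-Probability.Probability"
begin

text \<open>
  A law \<open>M\<close> on a Euclidean space is symmetric \<open>\<alpha>\<close>-stable. The two coordinates of \<open>M \<Otimes>\<^sub>M M\<close> play the
  role of two independent copies of a random vector with law \<open>M\<close>.
\<close>

definition symmetric_stable :: "real \<Rightarrow> 'a::euclidean_space measure \<Rightarrow> bool" where
  "symmetric_stable \<alpha> M \<longleftrightarrow>
     prob_space M \<and> sets M = sets borel \<and>
     distr M borel (\<lambda>x. - x) = M \<and>
     (\<forall>a>0. \<forall>b>0.
        distr (M \<Otimes>\<^sub>M M) borel (\<lambda>(x, y). (a powr (1 / \<alpha>)) *\<^sub>R x + (b powr (1 / \<alpha>)) *\<^sub>R y) =
        distr M borel (\<lambda>x. ((a + b) powr (1 / \<alpha>)) *\<^sub>R x))"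

definition spectral_norm :: "real \<Rightarrow> 'a::euclidean_space measure \<Rightarrow> 'a \<Rightarrow> real" where
  "spectral_norm \<alpha> \<sigma> u = (LINT z|\<sigma>. \<bar>u \<bullet> z\<bar> powr \<alpha>) powr (1 / \<alpha>)"

definition spectral_measure :: "real \<Rightarrow> 'a::euclidean_space measure \<Rightarrow> 'a measure \<Rightarrow> bool" where
  "spectral_measure \<alpha> M \<sigma> \<longleftrightarrow>
     sets \<sigma> = sets (restrict_space borel (sphere 0 1)) \<and>
     finite_measure \<sigma> \<and>
     distr \<sigma> (restrict_space borel (sphere 0 1)) (\<lambda>z. - z) = \<sigma> \<and>
     (\<forall>u. (CLINT x|M. iexp (x \<bullet> u)) = of_real (exp (- (spectral_norm \<alpha> \<sigma> u powr \<alpha>))))"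

text \<open>
  The star body is determined by \<open>M\<close>, since the values of the characteristic function determine
  \<^term>\<open>spectral_norm \<alpha> \<sigma>\<close>; the spectral measure itself is not unique for \<open>\<alpha> = 2\<close>.
\<close>

definition associated_star_body :: "real \<Rightarrow> 'a::euclidean_space measure \<Rightarrow> 'a set \<Rightarrow> bool" where
  "associated_star_body \<alpha> M F \<longleftrightarrow>
     (\<exists>\<sigma>. spectral_measure \<alpha> M \<sigma> \<and> F = {u. spectral_norm \<alpha> \<sigma> u \<le> 1})"

definition orthonormal_basis_of :: "'a::euclidean_space set \<Rightarrow> 'a set \<Rightarrow> bool" where
  "orthonormal_basis_of W B \<longleftrightarrow> pairwise orthogonal B \<and> (\<forall>b\<in>B. norm b = 1) \<and> span B = W"

lemma orthonormal_basis_of_exists: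
  assumes "subspace W"
  shows "\<exists>B. orthonormal_basis_of W B"
  using orthonormal_basis_subspace[OF assms] unfolding orthonormal_basis_of_def by metis

text \<open>
  Lebesgue measure of dimension \<open>dim W\<close> on a linear subspace \<open>W\<close>, regarded as a measure on the
  ambient space. It is built from an orthonormal basis of \<open>W\<close> in the way \<^const>\<open>lborel\<close> is built from
  \<^const>\<open>Basis\<close>; by rotation invariance the choice of the basis is irrelevant. For \<open>W = {0}\<close> the
  basis is empty and the result is the unit point mass at \<open>0\<close>.
\<close>

definition subspace_lborel :: "'a::euclidean_space set \<Rightarrow> 'a measure" where
  "subspace_lborel W =
     (let B = (SOME B. orthonormal_basis_of W B)
      in distr (\<Pi>\<^sub>M b\<in>B. lborel) borel (\<lambda>x. \<Sum>b\<in>B. x b *\<^sub>R b))"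

end

theory Submission
  imports Defs
begin

text \<open>
  Write \<open>d = DIM('a)\<close> and let \<open>\<psi> v = exp (- (spectral_norm \<alpha> \<sigma> v powr \<alpha>))\<close> be the characteristic function
  of the law. Formally, integrating the inversion formula
  \<open>f x = (2\<pi>)\<^sup>-\<^sup>d \<integral> exp (-\<i>(x \<bullet> v)) \<psi> v dv\<close> over the line \<open>x = t u\<close> turns the phases into a delta function
  in the variable \<open>u \<bullet> v\<close>, so that \<open>\<integral> f (t u) dt\<close> is \<open>(2\<pi>)\<^sup>1\<^sup>-\<^sup>d\<close> times the integral of \<open>\<psi>\<close> over the
  hyperplane \<open>u\<^sup>\<bottom>\<close>. On the hyperplane, \<open>\<psi>\<close> is the exponential of a homogeneous function, and the layer
  cake formula (\<open>nn_integral_exp_gauge\<close>) writes its integral as that of \<open>exp (- t)\<close> times the volume of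
  \<open>{y \<in> u\<^sup>\<bottom>. spectral_norm \<alpha> \<sigma> y powr \<alpha> \<le> t}\<close> over \<open>t > 0\<close>. This set is a dilate of \<open>F \<inter> u\<^sup>\<bottom>\<close>,
  so its volume is \<open>t powr ((d - 1) / \<alpha>)\<close> times that of \<open>F \<inter> u\<^sup>\<bottom>\<close>, and what remains is Euler's integral
  for \<open>Gamma (1 + (d - 1) / \<alpha>)\<close>.

  To make the first step rigorous, the line integral is weighted with the Gaussian
  \<open>exp (- (\<epsilon> t)\<^sup>2 / 2)\<close>. Fubini's theorem then replaces the delta function by a Gaussian of width \<open>\<epsilon>\<close> in
  the direction \<open>u\<close> (\<open>nn_integral_line_gaussian\<close>). As \<open>\<epsilon>\<close> tends to \<open>0\<close>, the left side converges
  monotonically because \<open>f\<close> is nonnegative, and the right side converges by dominated convergence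
  because \<open>\<psi> v\<close> is at most \<open>exp (- ((c * norm v) powr \<alpha>))\<close> for some \<open>c > 0\<close>
  (\<open>nn_integral_line_eq_orthogonal_section\<close>). The constant \<open>c\<close> comes from the existence of a density: if
  the spectral norm vanished at some \<open>v \<noteq> 0\<close>, the law would be carried by countably many hyperplanes
  orthogonal to \<open>v\<close> (\<open>char_eq_one_imp_zero\<close>); so the spectral norm is positive on the unit sphere, and
  by continuity and compactness bounded below there.

  Two general facts support this argument. The inversion formula for a nonnegative continuous density
  with integrable Fourier transform (\<open>fourier_inversion_nonneg\<close>) also comes from Gaussian averages. The
  splitting of Lebesgue measure along \<open>u\<close> and \<open>u\<^sup>\<bottom>\<close> (\<open>nn_integral_lborel_orthogonal_split\<close>)
  rests on the fact that every orthonormal basis gives the same Lebesgue measure, which follows from the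
  uniqueness of translation invariant measures.
\<close>

section \<open>Lebesgue measure in an arbitrary orthonormal basis\<close>

lemma finite_orthonormal_basis_of:
  fixes B :: "'a::euclidean_space set"
  assumes "orthonormal_basis_of W B"
  shows "finite B"
  using assms pairwise_orthogonal_imp_finite unfolding orthonormal_basis_of_def by blast

lemma orthonormal_basis_of_expand:
  fixes B :: "'a::euclidean_space set"
  assumes "orthonormal_basis_of W B" "x \<in> W"
  shows "(\<Sum>b\<in>B. (b \<bullet> x) *\<^sub>R b) = x"
  using assms finite_orthonormal_basis_of[OF assms(1)] unfolding orthonormal_basis_of_def
  by (subst inner_commute, intro orthonormal_basis_expand) auto

lemma card_orthonormal_basis_of_UNIV:
  fixes B :: "'a::euclidean_space set"
  assumes "orthonormal_basis_of UNIV B"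
  shows "card B = DIM('a)"
proof -
  have "0 \<notin> B"
    using assms unfolding orthonormal_basis_of_def by force
  then have "independent B"
    using assms pairwise_orthogonal_independent unfolding orthonormal_basis_of_def by blast
  then have "card B = dim (UNIV :: 'a set)"
    using assms dim_eq_card unfolding orthonormal_basis_of_def by (metis dim_span)
  then show ?thesis by simp
qed

lemma norm_orthonormal_sum_squared:
  assumes "orthonormal_basis_of W B"
  shows "(norm (\<Sum>b\<in>B. x b *\<^sub>R b))\<^sup>2 = (\<Sum>b\<in>B. (x b)\<^sup>2)"
proof -
  have B: "finite B" "\<And>b. b \<in> B \<Longrightarrow> norm b = 1" "pairwise orthogonal B"
    using assms finite_orthonormal_basis_of unfolding orthonormal_basis_of_def by auto
  have "(norm (\<Sum>b\<in>B. x b *\<^sub>R b))\<^sup>2 = (\<Sum>b\<in>B. (norm (x b *\<^sub>R b))\<^sup>2)"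
    using B(1,3)
    by (intro norm_sum_Pythagorean) (auto simp: pairwise_def orthogonal_def)
  also have "\<dots> = (\<Sum>b\<in>B. (x b)\<^sup>2)"
    using B(2) by (intro sum.cong) auto
  finally show ?thesis .
qed

lemma nn_integral_gaussian:
  "(\<integral>\<^sup>+ t. ennreal (exp (- t\<^sup>2 / 2)) \<partial>lborel) = ennreal (sqrt (2 * pi))"
proof -
  have "(\<integral>\<^sup>+ t. ennreal (exp (- t\<^sup>2 / 2)) \<partial>lborel)
      = (\<integral>\<^sup>+ t. ennreal (sqrt (2 * pi)) * ennreal (normal_density 0 1 t) \<partial>lborel)"
    by (simp add: normal_density_def flip: ennreal_mult)
  also have "\<dots> = ennreal (sqrt (2 * pi)) * (\<integral>\<^sup>+ t. ennreal (normal_density 0 1 t) \<partial>lborel)"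
    by (simp add: nn_integral_cmult)
  also have "(\<integral>\<^sup>+ t. ennreal (normal_density 0 1 t) \<partial>lborel) = 1"
    by (subst nn_integral_eq_integral) (auto simp: integrable_normal_density integral_normal_density)
  finally show ?thesis by simp
qed

lemma PiM_lborel_translation:
  fixes a :: "'i \<Rightarrow> real"
  assumes "finite B"
  shows "distr (\<Pi>\<^sub>M b\<in>B. lborel) (\<Pi>\<^sub>M b\<in>B. lborel) (\<lambda>x. \<lambda>b\<in>B. x b + a b) = (\<Pi>\<^sub>M b\<in>B. lborel)"
proof -
  interpret product_sigma_finite "\<lambda>_::'i. lborel :: real measure" by standard
  show ?thesis
  proof (rule PiM_eqI[OF assms])
    fix A :: "'i \<Rightarrow> real set" assume A: "\<And>b. b \<in> B \<Longrightarrow> A b \<in> sets lborel"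
    have "emeasure (distr (\<Pi>\<^sub>M b\<in>B. lborel) (\<Pi>\<^sub>M b\<in>B. lborel) (\<lambda>x. \<lambda>b\<in>B. x b + a b)) (Pi\<^sub>E B A)
        = emeasure (\<Pi>\<^sub>M b\<in>B. lborel)
            ((\<lambda>x. \<lambda>b\<in>B. x b + a b) -` Pi\<^sub>E B A \<inter> space (\<Pi>\<^sub>M b\<in>B. lborel))"
    proof (rule emeasure_distr)
      show "(\<lambda>x. \<lambda>b\<in>B. x b + a b) \<in> (\<Pi>\<^sub>M b\<in>B. lborel) \<rightarrow>\<^sub>M (\<Pi>\<^sub>M b\<in>B. lborel)"
        by measurable
    qed (use A assms in \<open>simp add: sets_PiM_I_finite\<close>)
    also have "(\<lambda>x. \<lambda>b\<in>B. x b + a b) -` Pi\<^sub>E B A \<inter> space (\<Pi>\<^sub>M b\<in>B. lborel)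
        = (\<Pi>\<^sub>E b\<in>B. (+) (a b) -` A b)"
      by (auto simp: space_PiM PiE_iff add.commute)
    also have "emeasure (\<Pi>\<^sub>M b\<in>B. lborel) \<dots> = (\<Prod>b\<in>B. emeasure lborel ((+) (a b) -` A b))"
    proof (rule emeasure_PiM[OF assms])
      fix b assume "b \<in> B"
      moreover have "(+) (a b) \<in> borel_measurable borel" by measurable
      ultimately show "(+) (a b) -` A b \<in> sets lborel"
        using A measurable_sets[of "(+) (a b)" borel borel "A b"] by simp
    qed
    also have "\<dots> = (\<Prod>b\<in>B. emeasure lborel (A b))"
    proof (intro prod.cong refl)
      fix b assume "b \<in> B"
      then have "emeasure (distr lborel borel ((+) (a b))) (A b) = emeasure lborel ((+) (a b) -` A b)"
        using A by (subst emeasure_distr) auto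
      then show "emeasure lborel ((+) (a b) -` A b) = emeasure lborel (A b)"
        by (simp add: lborel_distr_plus)
    qed
    finally show "emeasure (distr (\<Pi>\<^sub>M b\<in>B. lborel) (\<Pi>\<^sub>M b\<in>B. lborel) (\<lambda>x. \<lambda>b\<in>B. x b + a b)) (Pi\<^sub>E B A)
        = (\<Prod>b\<in>B. emeasure lborel (A b))" .
  qed simp
qed

text \<open>
  The Gaussian integral depends on the basis only through its cardinality. It is the test integral
  that fixes the normalization constant when two translation invariant measures are compared.
\<close>

lemma nn_integral_gaussian_orthonormal:
  fixes B :: "'a::euclidean_space set"
  assumes "orthonormal_basis_of W B"
  shows "(\<integral>\<^sup>+ x. ennreal (exp (- (norm (\<Sum>b\<in>B. x b *\<^sub>R b))\<^sup>2 / 2)) \<partial>(\<Pi>\<^sub>M b\<in>B. lborel))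
       = ennreal (sqrt (2 * pi)) ^ card B"
proof -
  interpret product_sigma_finite "\<lambda>_::'a. lborel :: real measure" by standard
  have fin: "finite B" by (rule finite_orthonormal_basis_of[OF assms])
  have "ennreal (exp (- (norm (\<Sum>b\<in>B. x b *\<^sub>R b))\<^sup>2 / 2)) = (\<Prod>b\<in>B. ennreal (exp (- (x b)\<^sup>2 / 2)))"
    for x
    by (simp add: norm_orthonormal_sum_squared[OF assms] prod_ennreal exp_sum[OF fin]
        sum_divide_distrib flip: sum_negf)
  then show ?thesis
    using product_nn_integral_prod[OF fin, of "\<lambda>_ t. ennreal (exp (- t\<^sup>2 / 2))"] nn_integral_gaussian
    by simp
qed

text \<open>
  The usual uniqueness argument for Haar measure: computing \<open>\<integral>\<integral> h x * indicator A y\<close> against \<open>lborel\<close> and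
  \<open>\<mu>\<close>, and shifting once with each measure, interchanges the roles of \<open>\<mu>\<close> and \<open>lborel\<close>. Evenness of the
  test function \<open>h\<close> absorbs the reflection that the two shifts leave behind.
\<close>

lemma translation_invariant_unique:
  fixes \<mu> :: "'a::euclidean_space measure"
  assumes [measurable_cong]: "sets \<mu> = sets borel" and "sigma_finite_measure \<mu>"
    and inv: "\<And>a g. g \<in> borel_measurable borel \<Longrightarrow> (\<integral>\<^sup>+ x. g (x + a) \<partial>\<mu>) = (\<integral>\<^sup>+ x. g x \<partial>\<mu>)"
    and [measurable]: "h \<in> borel_measurable borel"
    and even: "\<And>x. h (- x) = h x"
    and eq: "(\<integral>\<^sup>+ x. h x \<partial>\<mu>) = (\<integral>\<^sup>+ x. h x \<partial>lborel)"
    and pos: "(\<integral>\<^sup>+ x. h x \<partial>lborel) \<noteq> 0" and fin: "(\<integral>\<^sup>+ x. h x \<partial>lborel) \<noteq> \<infinity>"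
  shows "\<mu> = lborel"
proof (rule measure_eqI)
  interpret sigma_finite_measure \<mu> by fact
  interpret L: pair_sigma_finite \<mu> "lborel :: 'a measure" by standard
  fix A assume "A \<in> sets \<mu>"
  then have [measurable]: "A \<in> sets borel" by (simp add: assms)
  let ?g = "indicator A :: 'a \<Rightarrow> ennreal"
  have inv': "(\<integral>\<^sup>+ x. k (x + a) \<partial>lborel) = (\<integral>\<^sup>+ x. k x \<partial>lborel)"
    if [measurable]: "k \<in> borel_measurable borel" for k :: "'a \<Rightarrow> ennreal" and a
  proof -
    have "(\<integral>\<^sup>+ x. k x \<partial>lborel) = (\<integral>\<^sup>+ x. k x \<partial>distr lborel borel ((+) a))"
      by (simp add: lborel_distr_plus)
    also have "\<dots> = (\<integral>\<^sup>+ x. k (x + a) \<partial>lborel)"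
      by (subst nn_integral_distr) (simp_all add: add.commute)
    finally show ?thesis by simp
  qed
  have "(\<integral>\<^sup>+ x. h x \<partial>lborel) * (\<integral>\<^sup>+ y. ?g y \<partial>\<mu>) = (\<integral>\<^sup>+ y. (\<integral>\<^sup>+ x. h x * ?g y \<partial>lborel) \<partial>\<mu>)"
    by (simp add: nn_integral_multc nn_integral_cmult)
  also have "\<dots> = (\<integral>\<^sup>+ y. (\<integral>\<^sup>+ x. h (x - y) * ?g y \<partial>lborel) \<partial>\<mu>)"
  proof (rule nn_integral_cong)
    fix y show "(\<integral>\<^sup>+ x. h x * ?g y \<partial>lborel) = (\<integral>\<^sup>+ x. h (x - y) * ?g y \<partial>lborel)"
      using inv'[of "\<lambda>x. h x * ?g y" "- y"] by simp
  qed
  also have "\<dots> = (\<integral>\<^sup>+ x. (\<integral>\<^sup>+ y. h (x - y) * ?g y \<partial>\<mu>) \<partial>lborel)"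
    by (rule L.Fubini'[symmetric]) measurable
  also have "\<dots> = (\<integral>\<^sup>+ x. (\<integral>\<^sup>+ y. h y * ?g (y + x) \<partial>\<mu>) \<partial>lborel)"
  proof (rule nn_integral_cong)
    fix x show "(\<integral>\<^sup>+ y. h (x - y) * ?g y \<partial>\<mu>) = (\<integral>\<^sup>+ y. h y * ?g (y + x) \<partial>\<mu>)"
      using inv[of "\<lambda>y. h (x - y) * ?g y" x] by (simp add: even)
  qed
  also have "\<dots> = (\<integral>\<^sup>+ y. (\<integral>\<^sup>+ x. h y * ?g (y + x) \<partial>lborel) \<partial>\<mu>)"
    by (rule L.Fubini') measurable
  also have "\<dots> = (\<integral>\<^sup>+ y. h y * (\<integral>\<^sup>+ x. ?g x \<partial>lborel) \<partial>\<mu>)"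
  proof (rule nn_integral_cong)
    fix y show "(\<integral>\<^sup>+ x. h y * ?g (y + x) \<partial>lborel) = h y * (\<integral>\<^sup>+ x. ?g x \<partial>lborel)"
      using inv'[of ?g y] by (simp add: nn_integral_cmult add.commute)
  qed
  also have "\<dots> = (\<integral>\<^sup>+ x. h x \<partial>lborel) * (\<integral>\<^sup>+ x. ?g x \<partial>lborel)"
    by (simp add: nn_integral_multc eq)
  finally show "emeasure \<mu> A = emeasure lborel A"
    using pos fin by (auto simp: ennreal_mult_cancel_left assms(1))
qed (simp add: assms)

text \<open>
  The measure built from \<open>B\<close> is translation invariant, since translating a point translates its
  coordinates, and gives the Gaussian the same integral as \<open>lborel\<close>.
\<close>

lemma lborel_eq_distr_orthonormal:
  fixes B :: "'a::euclidean_space set"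
  assumes "orthonormal_basis_of UNIV B"
  shows "distr (\<Pi>\<^sub>M b\<in>B. lborel) borel (\<lambda>x. \<Sum>b\<in>B. x b *\<^sub>R b) = (lborel :: 'a measure)"
proof -
  let ?L = "\<lambda>x. \<Sum>b\<in>B. x b *\<^sub>R b" and ?P = "\<Pi>\<^sub>M b\<in>B. lborel :: real measure"
  let ?G = "\<lambda>x::'a. ennreal (exp (- (norm x)\<^sup>2 / 2))"
  have fin: "finite B" by (rule finite_orthonormal_basis_of[OF assms])
  have basis: "orthonormal_basis_of UNIV (Basis :: 'a set)"
    unfolding orthonormal_basis_of_def by (auto simp: pairwise_def orthogonal_def inner_Basis)
  have [measurable]: "?L \<in> ?P \<rightarrow>\<^sub>M borel" by measurable
  have G1: "(\<integral>\<^sup>+ x. ?G x \<partial>distr ?P borel ?L) = ennreal (sqrt (2 * pi)) ^ DIM('a)"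
    using nn_integral_gaussian_orthonormal[OF assms] card_orthonormal_basis_of_UNIV[OF assms]
    by (simp add: nn_integral_distr)
  have G2: "(\<integral>\<^sup>+ x. ?G x \<partial>lborel) = ennreal (sqrt (2 * pi)) ^ DIM('a)"
    using nn_integral_gaussian_orthonormal[OF basis] by (subst lborel_eq) (simp add: nn_integral_distr)
  have inv: "(\<integral>\<^sup>+ x. g (x + a) \<partial>distr ?P borel ?L) = (\<integral>\<^sup>+ x. g x \<partial>distr ?P borel ?L)"
    if [measurable]: "g \<in> borel_measurable borel" for g :: "'a \<Rightarrow> ennreal" and a
  proof -
    have "(\<integral>\<^sup>+ x. g x \<partial>distr ?P borel ?L) = (\<integral>\<^sup>+ x. g (?L x) \<partial>distr ?P ?P (\<lambda>x. \<lambda>b\<in>B. x b + b \<bullet> a))"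
      by (simp add: nn_integral_distr PiM_lborel_translation[OF fin])
    also have "\<dots> = (\<integral>\<^sup>+ x. g (?L (\<lambda>b\<in>B. x b + b \<bullet> a)) \<partial>?P)"
      by (intro nn_integral_distr) measurable
    also have "\<dots> = (\<integral>\<^sup>+ x. g (?L x + a) \<partial>?P)"
      using orthonormal_basis_of_expand[OF assms, of a]
      by (intro nn_integral_cong) (simp add: scaleR_add_left sum.distrib)
    finally show ?thesis by (simp add: nn_integral_distr)
  qed
  have sf: "sigma_finite_measure (distr ?P borel ?L)"
  proof -
    \<comment> \<open>Balls have finite measure because the Gaussian is integrable and bounded below on them.\<close>
    have emb: "emeasure (distr ?P borel ?L) (cball 0 (real n)) \<noteq> \<infinity>" for n
    proof -
      have "ennreal (exp (- (real n)\<^sup>2 / 2)) * emeasure (distr ?P borel ?L) (cball 0 (real n))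
          = (\<integral>\<^sup>+ x. ennreal (exp (- (real n)\<^sup>2 / 2)) * indicator (cball 0 (real n)) x \<partial>distr ?P borel ?L)"
        by (subst nn_integral_cmult_indicator) auto
      also have "\<dots> \<le> (\<integral>\<^sup>+ x. ?G x \<partial>distr ?P borel ?L)"
        by (intro nn_integral_mono) (auto simp: indicator_def power_mono)
      also have "\<dots> < \<infinity>"
        unfolding G1 by (simp add: ennreal_power)
      finally show ?thesis
        by (auto simp: ennreal_mult_eq_top_iff)
    qed
    show ?thesis
      by standard (intro exI[of _ "range (\<lambda>n. cball 0 (real n))"], use emb in \<open>auto intro: real_arch_simple\<close>)
  qed
  have "(\<integral>\<^sup>+ x. ?G x \<partial>lborel) \<noteq> 0" "(\<integral>\<^sup>+ x. ?G x \<partial>lborel) \<noteq> \<infinity>"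
    unfolding G2 by (simp_all add: ennreal_power)
  then show ?thesis
    by (intro translation_invariant_unique[where h = ?G]) (use inv sf in \<open>simp_all only: G1 G2\<close>, simp_all)
qed

section \<open>Splitting Lebesgue measure along a direction\<close>

lemma subspace_lborel_orthonormal_basis:
  fixes W :: "'a::euclidean_space set"
  assumes "subspace W"
  obtains B where "orthonormal_basis_of W B"
    "subspace_lborel W = distr (\<Pi>\<^sub>M b\<in>B. lborel) borel (\<lambda>x. \<Sum>b\<in>B. x b *\<^sub>R b)"
proof
  show "orthonormal_basis_of W (SOME B. orthonormal_basis_of W B)"
    by (rule someI_ex) (rule orthonormal_basis_of_exists[OF assms])
qed (simp add: subspace_lborel_def Let_def)

lemma orthonormal_basis_of_orthogonal_comp:
  assumes "orthonormal_basis_of ({u}\<^sup>\<bottom>) B" "b \<in> B"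
  shows "u \<bullet> b = 0"
  using assms span_superset[of B]
  unfolding orthonormal_basis_of_def orthogonal_comp_def orthogonal_def by auto

text \<open>
  Adjoining \<open>u\<close> to the orthonormal basis that defines \<open>subspace_lborel ({u}\<^sup>\<bottom>)\<close> gives an
  orthonormal basis of the whole space, so the claim is Fubini's theorem for the product measure.
\<close>

lemma nn_integral_lborel_orthogonal_split:
  fixes u :: "'a::euclidean_space"
  assumes u: "norm u = 1" and [measurable]: "g \<in> borel_measurable borel"
  shows "(\<integral>\<^sup>+ x. g x \<partial>lborel)
       = (\<integral>\<^sup>+ s. (\<integral>\<^sup>+ y. g (s *\<^sub>R u + y) \<partial>subspace_lborel ({u}\<^sup>\<bottom>)) \<partial>lborel)"
proof -
  interpret product_sigma_finite "\<lambda>_::'a. lborel :: real measure" by standard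
  obtain B where B: "orthonormal_basis_of ({u}\<^sup>\<bottom>) B"
    and L: "subspace_lborel ({u}\<^sup>\<bottom>) = distr (\<Pi>\<^sub>M b\<in>B. lborel) borel (\<lambda>x. \<Sum>b\<in>B. x b *\<^sub>R b)"
    by (rule subspace_lborel_orthonormal_basis[OF subspace_orthogonal_comp])
  have fin: "finite B" by (rule finite_orthonormal_basis_of[OF B])
  have perp: "u \<bullet> b = 0" if "b \<in> B" for b
    by (rule orthonormal_basis_of_orthogonal_comp[OF B that])
  have uB: "u \<notin> B" using perp[of u] u by (auto simp: norm_eq_1)
  have "x \<in> span (insert u B)" for x
  proof -
    have "x - (u \<bullet> x) *\<^sub>R u \<in> span B"
      using B u unfolding orthonormal_basis_of_def
      by (auto simp: orthogonal_comp_def orthogonal_def inner_diff_right norm_eq_1)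
    then show ?thesis by (auto simp: span_insert)
  qed
  then have uB': "orthonormal_basis_of UNIV (insert u B)"
    using B u perp unfolding orthonormal_basis_of_def
    by (auto simp: pairwise_insert orthogonal_def inner_commute)
  have "(\<integral>\<^sup>+ x. g x \<partial>lborel) = (\<integral>\<^sup>+ x. g (\<Sum>b\<in>insert u B. x b *\<^sub>R b) \<partial>(\<Pi>\<^sub>M b\<in>insert u B. lborel))"
    unfolding lborel_eq_distr_orthonormal[OF uB', symmetric] by (intro nn_integral_distr) measurable
  also have "\<dots> = (\<integral>\<^sup>+ s. (\<integral>\<^sup>+ x. g (\<Sum>b\<in>insert u B. (x(u := s)) b *\<^sub>R b) \<partial>(\<Pi>\<^sub>M b\<in>B. lborel)) \<partial>lborel)"
    using fin uB by (intro product_nn_integral_insert_rev) auto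
  also have "\<dots> = (\<integral>\<^sup>+ s. (\<integral>\<^sup>+ y. g (s *\<^sub>R u + y) \<partial>subspace_lborel ({u}\<^sup>\<bottom>)) \<partial>lborel)"
  proof (rule nn_integral_cong)
    fix s :: real
    have "(\<Sum>b\<in>insert u B. (x(u := s)) b *\<^sub>R b) = s *\<^sub>R u + (\<Sum>b\<in>B. x b *\<^sub>R b)" for x
      using fin uB by (subst sum.insert) (auto intro!: sum.cong)
    then show "(\<integral>\<^sup>+ x. g (\<Sum>b\<in>insert u B. (x(u := s)) b *\<^sub>R b) \<partial>(\<Pi>\<^sub>M b\<in>B. lborel))
      = (\<integral>\<^sup>+ y. g (s *\<^sub>R u + y) \<partial>subspace_lborel ({u}\<^sup>\<bottom>))"
      unfolding L by (simp add: nn_integral_distr)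
  qed
  finally show ?thesis .
qed

lemma sets_subspace_lborel [simp, measurable_cong]: "sets (subspace_lborel W) = sets borel"
  by (simp add: subspace_lborel_def Let_def)

lemma space_subspace_lborel [simp]: "space (subspace_lborel W) = UNIV"
  by (simp add: subspace_lborel_def Let_def)

lemma AE_subspace_lborel_orthogonal_comp:
  fixes u :: "'a::euclidean_space"
  shows "AE y in subspace_lborel ({u}\<^sup>\<bottom>). u \<bullet> y = 0"
proof -
  obtain B where B: "orthonormal_basis_of ({u}\<^sup>\<bottom>) B"
    and L: "subspace_lborel ({u}\<^sup>\<bottom>) = distr (\<Pi>\<^sub>M b\<in>B. lborel) borel (\<lambda>x. \<Sum>b\<in>B. x b *\<^sub>R b)"
    by (rule subspace_lborel_orthonormal_basis[OF subspace_orthogonal_comp])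
  have "u \<bullet> (\<Sum>b\<in>B. x b *\<^sub>R b) = 0" for x
    by (simp add: inner_sum_right orthonormal_basis_of_orthogonal_comp[OF B])
  then show ?thesis
    unfolding L by (subst AE_distr_iff) auto
qed

text \<open>
  The slab of height \<open>h\<close> over the part of \<open>S\<close> in the hyperplane turns a measure of dimension
  \<open>DIM('a) - 1\<close> into a Lebesgue measure. In this way properties of \<open>lborel\<close> such as scaling carry over
  to the hyperplane.
\<close>

lemma emeasure_lborel_slab:
  fixes u :: "'a::euclidean_space"
  assumes u: "norm u = 1" and [measurable]: "S \<in> sets borel" and "0 \<le> h"
  shows "emeasure lborel {x. u \<bullet> x \<in> {0..h} \<and> x - (u \<bullet> x) *\<^sub>R u \<in> S}
       = ennreal h * emeasure (subspace_lborel ({u}\<^sup>\<bottom>)) S"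
proof -
  let ?T = "{x. u \<bullet> x \<in> {0..h} \<and> x - (u \<bullet> x) *\<^sub>R u \<in> S}"
  have [measurable]: "?T \<in> sets borel" by measurable
  have "emeasure lborel ?T
      = (\<integral>\<^sup>+ s. (\<integral>\<^sup>+ y. indicator ?T (s *\<^sub>R u + y) \<partial>subspace_lborel ({u}\<^sup>\<bottom>)) \<partial>lborel)"
    using nn_integral_lborel_orthogonal_split[OF u, of "indicator ?T"] by simp
  also have "\<dots> = (\<integral>\<^sup>+ s. (\<integral>\<^sup>+ y. indicator {0..h} s * indicator S y \<partial>subspace_lborel ({u}\<^sup>\<bottom>)) \<partial>lborel)"
  proof (rule nn_integral_cong, rule nn_integral_cong_AE)
    fix s :: real
    show "AE y in subspace_lborel ({u}\<^sup>\<bottom>). indicator ?T (s *\<^sub>R u + y)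
        = (indicator {0..h} s * indicator S y :: ennreal)"
      using AE_subspace_lborel_orthogonal_comp[of u]
    proof eventually_elim
      case (elim y)
      then have "u \<bullet> (s *\<^sub>R u + y) = s" using u by (simp add: inner_add_right norm_eq_1)
      then show ?case by (auto simp: indicator_def)
    qed
  qed
  also have "\<dots> = ennreal h * emeasure (subspace_lborel ({u}\<^sup>\<bottom>)) S"
    using \<open>0 \<le> h\<close> by (simp add: nn_integral_cmult nn_integral_multc)
  finally show ?thesis .
qed

section \<open>Homogeneous measures and sublevel sets of gauges\<close>

text \<open>
  The layer cake computation rests on the behaviour of a measure under dilations. It is carried out
  twice: for Lebesgue measure, to show that the characteristic function is integrable, and for the
  measure on the hyperplane, to obtain the volume of the section.
\<close>

locale homogeneous_measure =
  fixes \<mu> :: "'a::euclidean_space measure" and k :: nat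
  assumes sets_eq [simp, measurable_cong]: "sets \<mu> = sets borel"
    and finite_bounded: "\<And>S. S \<in> sets borel \<Longrightarrow> bounded S \<Longrightarrow> emeasure \<mu> S < \<infinity>"
    and emeasure_scale: "\<And>S r. S \<in> sets borel \<Longrightarrow> 0 < r \<Longrightarrow>
          emeasure \<mu> S = ennreal (r ^ k) * emeasure \<mu> {x. r *\<^sub>R x \<in> S}"
begin

lemma space_eq [simp]: "space \<mu> = UNIV"
  using sets_eq_imp_space_eq[OF sets_eq] by simp

sublocale sigma_finite_measure \<mu>
proof
  have "emeasure \<mu> (cball 0 (real n)) \<noteq> \<infinity>" for n
    using finite_bounded[of "cball 0 (real n)"] by auto
  then show "\<exists>A. countable A \<and> A \<subseteq> sets \<mu> \<and> \<Union> A = space \<mu> \<and> (\<forall>a\<in>A. emeasure \<mu> a \<noteq> \<infinity>)"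
    by (intro exI[of _ "range (\<lambda>n. cball 0 (real n))"]) (auto intro: real_arch_simple)
qed

lemma emeasure_sublevel_scale:
  fixes p :: "'a \<Rightarrow> real"
  assumes [measurable]: "p \<in> borel_measurable borel"
    and hom: "\<And>c x. p (c *\<^sub>R x) = \<bar>c\<bar> * p x" and "0 < \<alpha>" and nonneg: "\<And>x. 0 \<le> p x" and "0 < t"
  shows "emeasure \<mu> {x. p x powr \<alpha> \<le> t} = ennreal (t powr (real k / \<alpha>)) * emeasure \<mu> {x. p x \<le> 1}"
proof -
  define r where "r = t powr (1 / \<alpha>)"
  have r: "0 < r" "r powr \<alpha> = t" using assms by (auto simp: r_def powr_powr)
  have "p x powr \<alpha> \<le> t \<longleftrightarrow> p x \<le> r" for x
    using r nonneg[of x] \<open>0 < \<alpha>\<close> powr_less_mono2[of \<alpha> r "p x"] powr_mono2[of \<alpha> "p x" r]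
    by (metis less_eq_real_def not_le)
  then have "emeasure \<mu> {x. p x powr \<alpha> \<le> t} = emeasure \<mu> {x. p x \<le> r}" by simp
  also have "\<dots> = ennreal (r ^ k) * emeasure \<mu> {x. r *\<^sub>R x \<in> {x. p x \<le> r}}"
    using r by (intro emeasure_scale) auto
  also have "{x. r *\<^sub>R x \<in> {x. p x \<le> r}} = {x. p x \<le> 1}"
    using r by (auto simp: hom)
  also have "r ^ k = t powr (real k / \<alpha>)"
    using r \<open>0 < t\<close> by (simp add: powr_powr flip: powr_realpow) (simp add: r_def powr_powr)
  finally show ?thesis .
qed

text \<open>
  Layer cake formula: \<open>exp (- a)\<close> is the integral of \<open>exp (- t)\<close> over \<open>t \<ge> a\<close>, so after exchanging the
  integrals there remains the measure of the sublevel set \<open>{x. p x powr \<alpha> \<le> t}\<close>, which is a dilate of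
  \<open>{x. p x \<le> 1}\<close>, and Euler's integral for \<open>Gamma (1 + k / \<alpha>)\<close>.
\<close>

lemma nn_integral_exp_gauge:
  fixes p :: "'a \<Rightarrow> real"
  assumes [measurable]: "p \<in> borel_measurable borel"
    and hom: "\<And>c x. p (c *\<^sub>R x) = \<bar>c\<bar> * p x" and "0 < \<alpha>" and nonneg: "\<And>x. 0 \<le> p x"
  shows "(\<integral>\<^sup>+ x. ennreal (exp (- (p x powr \<alpha>))) \<partial>\<mu>)
       = ennreal (Gamma (1 + real k / \<alpha>)) * emeasure \<mu> {x. p x \<le> 1}"
proof -
  interpret L: pair_sigma_finite "lborel :: real measure" \<mu> by standard
  have tail: "(\<integral>\<^sup>+ t. ennreal (exp (- t)) * indicator {c..} t \<partial>lborel) = ennreal (exp (- c))" for c :: real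
  proof -
    have "((\<lambda>t::real. - exp (- t)) \<longlongrightarrow> 0) at_top"
      using tendsto_minus[OF filterlim_compose[OF exp_at_bot filterlim_uminus_at_bot_at_top]] by simp
    then have "(\<integral>\<^sup>+ t. ennreal (exp (- t)) * indicator {c..} t \<partial>lborel) = ennreal (0 - (- exp (- c)))"
      by (intro nn_integral_FTC_atLeast) (auto intro!: derivative_eq_intros)
    then show ?thesis by simp
  qed
  have "(\<integral>\<^sup>+ x. ennreal (exp (- (p x powr \<alpha>))) \<partial>\<mu>)
      = (\<integral>\<^sup>+ x. (\<integral>\<^sup>+ t. ennreal (exp (- t)) * indicator {x. p x powr \<alpha> \<le> t} x \<partial>lborel) \<partial>\<mu>)"
  proof (rule nn_integral_cong)
    fix x
    have "(\<integral>\<^sup>+ t. ennreal (exp (- t)) * indicator {x. p x powr \<alpha> \<le> t} x \<partial>lborel)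
        = (\<integral>\<^sup>+ t. ennreal (exp (- t)) * indicator {p x powr \<alpha>..} t \<partial>lborel)"
      by (intro nn_integral_cong) (auto simp: indicator_def)
    then show "ennreal (exp (- (p x powr \<alpha>)))
        = (\<integral>\<^sup>+ t. ennreal (exp (- t)) * indicator {x. p x powr \<alpha> \<le> t} x \<partial>lborel)"
      by (simp only: tail)
  qed
  also have "\<dots> = (\<integral>\<^sup>+ t. (\<integral>\<^sup>+ x. ennreal (exp (- t)) * indicator {x. p x powr \<alpha> \<le> t} x \<partial>\<mu>) \<partial>lborel)"
    by (rule L.Fubini') measurable
  also have "\<dots> = (\<integral>\<^sup>+ t. ennreal (exp (- t)) * emeasure \<mu> {x. p x powr \<alpha> \<le> t} \<partial>lborel)"
    by (simp add: nn_integral_cmult)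
  also have "\<dots> = (\<integral>\<^sup>+ t. ennreal (indicator {0..} t * t powr (1 + real k / \<alpha> - 1) / exp t)
                    * emeasure \<mu> {x. p x \<le> 1} \<partial>lborel)"
  proof (rule nn_integral_cong_AE)
    show "AE t in lborel. ennreal (exp (- t)) * emeasure \<mu> {x. p x powr \<alpha> \<le> t}
        = ennreal (indicator {0..} t * t powr (1 + real k / \<alpha> - 1) / exp t) * emeasure \<mu> {x. p x \<le> 1}"
      \<comment> \<open>At \<open>t = 0\<close> the scaling law fails if \<open>k = 0\<close>, because \<open>0 powr 0 = 0\<close>.\<close>
      using AE_lborel_singleton[of 0]
    proof eventually_elim
      case (elim t)
      show ?case
      proof (cases "0 < t")
        case True
        then show ?thesis
          using emeasure_sublevel_scale[OF assms True]
          by (simp add: exp_minus divide_inverse ennreal_mult mult_ac)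
      next
        case False
        then have "{x. p x powr \<alpha> \<le> t} = {}"
          using elim by (auto simp: not_le intro: less_le_trans[OF _ powr_ge_zero])
        then show ?thesis using False elim by simp
      qed
    qed
  qed
  also have "\<dots> = ennreal (Gamma (1 + real k / \<alpha>)) * emeasure \<mu> {x. p x \<le> 1}"
    using \<open>0 < \<alpha>\<close> by (subst nn_integral_multc) (auto simp: Gamma_conv_nn_integral_real add_pos_nonneg)
  finally show ?thesis .
qed

lemma nn_integral_exp_norm_finite:
  assumes "0 < \<alpha>" "0 < c"
  shows "(\<integral>\<^sup>+ x. ennreal (exp (- ((c * norm x) powr \<alpha>))) \<partial>\<mu>) < \<infinity>"
proof -
  have "{x::'a. c * norm x \<le> 1} \<subseteq> cball 0 (1 / c)"
    using assms by (auto simp: field_simps)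
  then have "bounded {x::'a. c * norm x \<le> 1}"
    using bounded_subset bounded_cball by blast
  then have "emeasure \<mu> {x. c * norm x \<le> 1} < \<infinity>"
    by (intro finite_bounded) measurable
  then show ?thesis
    using assms by (subst nn_integral_exp_gauge) (auto simp: ennreal_mult_less_top)
qed

end

lemma homogeneous_measure_lborel:
  "homogeneous_measure (lborel :: 'a::euclidean_space measure) DIM('a)"
proof
  fix S :: "'a set" and r :: real assume [measurable]: "S \<in> sets borel" and "0 < r"
  then have "emeasure lborel S
      = emeasure (density (distr lborel borel (\<lambda>x. 0 + r *\<^sub>R x)) (\<lambda>_. \<bar>r\<bar> ^ DIM('a))) S"
    using lborel_affine[of r "0::'a"] by simp
  also have "\<dots> = ennreal (r ^ DIM('a)) * emeasure lborel {x. r *\<^sub>R x \<in> S}"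
    using \<open>0 < r\<close>
    by (subst emeasure_density_const) (auto simp: emeasure_distr vimage_def)
  finally show "emeasure lborel S = ennreal (r ^ DIM('a)) * emeasure lborel {x. r *\<^sub>R x \<in> S}" .
qed (use emeasure_bounded_finite in auto)

text \<open>
  Dilating the slab of height \<open>1 / r\<close> over \<open>{x. r *\<^sub>R x \<in> S}\<close> by \<open>r\<close> gives the slab of height \<open>1\<close>
  over \<open>S\<close>; dividing out the height turns the exponent \<open>DIM('a)\<close> into \<open>DIM('a) - 1\<close>.
\<close>

lemma homogeneous_measure_subspace_lborel:
  fixes u :: "'a::euclidean_space"
  assumes u: "norm u = 1"
  shows "homogeneous_measure (subspace_lborel ({u}\<^sup>\<bottom>)) (DIM('a) - 1)"
proof
  interpret L: homogeneous_measure "lborel :: 'a measure" "DIM('a)" by (rule homogeneous_measure_lborel)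
  fix S :: "'a set" assume [measurable]: "S \<in> sets borel"
  let ?T = "\<lambda>h S. {x::'a. u \<bullet> x \<in> {0..h} \<and> x - (u \<bullet> x) *\<^sub>R u \<in> S}"
  have T [measurable]: "?T h S' \<in> sets borel" if [measurable]: "S' \<in> sets borel" for h S'
    by measurable
  show "emeasure (subspace_lborel ({u}\<^sup>\<bottom>)) S < \<infinity>" if "bounded S"
  proof -
    from that obtain R where R: "\<And>x. x \<in> S \<Longrightarrow> norm x \<le> R" by (auto simp: bounded_iff)
    have "?T 1 S \<subseteq> cball 0 (R + 1)"
    proof
      fix x assume x: "x \<in> ?T 1 S"
      have "norm x \<le> norm (x - (u \<bullet> x) *\<^sub>R u) + norm ((u \<bullet> x) *\<^sub>R u)"
        using norm_triangle_ineq[of "x - (u \<bullet> x) *\<^sub>R u" "(u \<bullet> x) *\<^sub>R u"] by simp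
      then show "x \<in> cball 0 (R + 1)" using R x u by fastforce
    qed
    then have "emeasure lborel (?T 1 S) < \<infinity>"
      by (intro emeasure_bounded_finite bounded_subset[OF bounded_cball])
    then show ?thesis using emeasure_lborel_slab[OF u, of S 1] by simp
  qed
  show "emeasure (subspace_lborel ({u}\<^sup>\<bottom>)) S
      = ennreal (r ^ (DIM('a) - 1)) * emeasure (subspace_lborel ({u}\<^sup>\<bottom>)) {x. r *\<^sub>R x \<in> S}"
    if r: "0 < r" for r
  proof -
    have "emeasure (subspace_lborel ({u}\<^sup>\<bottom>)) S = emeasure lborel (?T 1 S)"
      using emeasure_lborel_slab[OF u, of S 1] by simp
    also have "\<dots> = ennreal (r ^ DIM('a)) * emeasure lborel {x. r *\<^sub>R x \<in> ?T 1 S}"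
      using r by (intro L.emeasure_scale) auto
    also have "{x. r *\<^sub>R x \<in> ?T 1 S} = ?T (1 / r) {x. r *\<^sub>R x \<in> S}"
      using r by (auto simp: field_simps scaleR_diff_right zero_le_mult_iff)
    also have "emeasure lborel \<dots> = ennreal (1 / r) * emeasure (subspace_lborel ({u}\<^sup>\<bottom>)) {x. r *\<^sub>R x \<in> S}"
      using r by (intro emeasure_lborel_slab[OF u]) auto
    also have "ennreal (r ^ DIM('a)) * \<dots>
        = ennreal (r ^ DIM('a) * (1 / r)) * emeasure (subspace_lborel ({u}\<^sup>\<bottom>)) {x. r *\<^sub>R x \<in> S}"
      using r by (simp only: ennreal_mult mult.assoc zero_le_power less_imp_le zero_le_divide_1_iff)
    also have "r ^ DIM('a) * (1 / r) = r ^ (DIM('a) - 1)"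
      using r by (simp add: power_diff)
    finally show ?thesis .
  qed
qed simp

section \<open>Fourier transform of Gaussians\<close>

lemma gaussian_fourier_real:
  "integrable lborel (\<lambda>t::real. iexp (s * t) * exp (- t\<^sup>2 / 2))"
  "(CLINT t|lborel. iexp (s * t) * exp (- t\<^sup>2 / 2)) = sqrt (2 * pi) * exp (- s\<^sup>2 / 2)"
proof -
  have *: "iexp (s * t) * exp (- t\<^sup>2 / 2) = sqrt (2 * pi) *\<^sub>R (normal_density 0 1 t *\<^sub>R iexp (s * t))" for t
    by (simp add: normal_density_def scaleR_conv_of_real exp_of_real flip: of_real_mult)
  have int: "integrable lborel (\<lambda>t. normal_density 0 1 t *\<^sub>R iexp (s * t))"
    by (rule Bochner_Integration.integrable_bound[of _ "normal_density 0 1"])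
       (auto simp: integrable_normal_density)
  then show "integrable lborel (\<lambda>t::real. iexp (s * t) * exp (- t\<^sup>2 / 2))"
    unfolding * by (rule integrable_scaleR_right)
  have "char std_normal_distribution s = exp (- s\<^sup>2 / 2)"
    by (simp add: char_std_normal_distribution)
  then show "(CLINT t|lborel. iexp (s * t) * exp (- t\<^sup>2 / 2)) = sqrt (2 * pi) * exp (- s\<^sup>2 / 2)"
    unfolding * char_def by (simp add: integral_density integral_scaleR_right scaleR_conv_of_real)
qed

lemma gaussian_fourier:
  fixes v :: "'a::euclidean_space"
  shows "integrable lborel (\<lambda>x. iexp (v \<bullet> x) * exp (- (norm x)\<^sup>2 / 2))" (is "integrable _ ?g")
    and "(CLINT x|lborel. iexp (v \<bullet> x) * exp (- (norm x)\<^sup>2 / 2))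
       = sqrt (2 * pi) ^ DIM('a) * exp (- (norm v)\<^sup>2 / 2)"
proof -
  interpret product_sigma_finite "\<lambda>_::'a. lborel :: real measure" by standard
  let ?L = "\<lambda>x. \<Sum>b\<in>Basis. x b *\<^sub>R b :: 'a"
  let ?h = "\<lambda>b t. iexp ((v \<bullet> b) * t) * exp (- t\<^sup>2 / 2)"
  have sq: "(norm w)\<^sup>2 = (\<Sum>b\<in>Basis. (w \<bullet> b)\<^sup>2)" for w :: 'a
    by (simp add: norm_eq_sqrt_inner euclidean_inner[of w w] power2_eq_square sum_nonneg)
  have prod: "?g (?L x) = (\<Prod>b\<in>Basis. ?h b (x b))" for x
  proof -
    have "\<i> * of_real (v \<bullet> ?L x) = (\<Sum>b\<in>Basis. \<i> * of_real ((v \<bullet> b) * x b))"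
      by (simp add: inner_sum_right sum_distrib_left mult_ac)
    moreover have "- (norm (?L x))\<^sup>2 / 2 = (\<Sum>b\<in>Basis. - (x b)\<^sup>2 / 2)"
      by (simp add: sq sum_divide_distrib sum_negf)
    ultimately show ?thesis
      by (simp only: prod.distrib exp_sum[OF finite_Basis] of_real_prod)
  qed
  have [measurable]: "?g \<in> borel_measurable borel" by measurable
  have [measurable]: "?L \<in> (\<Pi>\<^sub>M b\<in>Basis. lborel) \<rightarrow>\<^sub>M borel" by measurable
  have "integrable (\<Pi>\<^sub>M b\<in>Basis. lborel) (\<lambda>x. \<Prod>b\<in>Basis. ?h b (x b))"
    by (intro product_integrable_prod gaussian_fourier_real) auto
  then show "integrable lborel ?g"
    by (subst lborel_eq, subst integrable_distr_eq) (simp_all only: prod, measurable)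
  have "(CLINT x|lborel. ?g x) = (CLINT x|(\<Pi>\<^sub>M b\<in>Basis. lborel). ?g (?L x))"
    by (subst lborel_eq, rule integral_distr) measurable
  also have "\<dots> = (\<Prod>b\<in>Basis. CLINT t|lborel. ?h b t)"
    unfolding prod by (intro product_integral_prod gaussian_fourier_real) auto
  also have "\<dots> = (\<Prod>b\<in>Basis. sqrt (2 * pi) * exp (- (v \<bullet> b)\<^sup>2 / 2))"
    by (simp only: gaussian_fourier_real of_real_prod)
  also have "\<dots> = sqrt (2 * pi) ^ DIM('a) * exp (- (norm v)\<^sup>2 / 2)"
  proof -
    have "- (norm v)\<^sup>2 / 2 = (\<Sum>b\<in>Basis. - (v \<bullet> b)\<^sup>2 / 2)"
      by (simp add: sq sum_divide_distrib sum_negf)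
    then show ?thesis
      by (simp only: prod.distrib prod_constant exp_sum[OF finite_Basis] of_real_mult of_real_power)
  qed
  finally show "(CLINT x|lborel. ?g x) = sqrt (2 * pi) ^ DIM('a) * exp (- (norm v)\<^sup>2 / 2)" .
qed

lemma lborel_affine_integral:
  fixes g :: "'a::euclidean_space \<Rightarrow> 'b::{banach, second_countable_topology}"
  assumes [measurable]: "g \<in> borel_measurable borel" and "0 < c"
  shows "(LINT x|lborel. g x) = c ^ DIM('a) *\<^sub>R (LINT x|lborel. g (a + c *\<^sub>R x))"
    and "integrable lborel g \<longleftrightarrow> integrable lborel (\<lambda>x. g (a + c *\<^sub>R x))"
proof -
  have L: "lborel = density (distr lborel borel (\<lambda>x. a + c *\<^sub>R x)) (\<lambda>_. \<bar>c\<bar> ^ DIM('a))"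
    using lborel_affine[of c a] \<open>0 < c\<close> by simp
  show "(LINT x|lborel. g x) = c ^ DIM('a) *\<^sub>R (LINT x|lborel. g (a + c *\<^sub>R x))"
    using \<open>0 < c\<close>
    by (subst L) (simp add: integral_density integral_distr integral_scaleR_right)
  show "integrable lborel g \<longleftrightarrow> integrable lborel (\<lambda>x. g (a + c *\<^sub>R x))"
  proof -
    have "integrable lborel (\<lambda>x. c ^ DIM('a) *\<^sub>R g (a + c *\<^sub>R x)) \<longleftrightarrow>
        integrable lborel (\<lambda>x. g (a + c *\<^sub>R x))"
      using integrable_scaleR_right[of "1 / c ^ DIM('a)" lborel "\<lambda>x. c ^ DIM('a) *\<^sub>R g (a + c *\<^sub>R x)"]
        \<open>0 < c\<close> by auto
    then show ?thesis
      using \<open>0 < c\<close> by (subst L) (simp add: integrable_density integrable_distr_eq)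
  qed
qed

lemma gaussian_fourier_scaled:
  fixes v :: "'a::euclidean_space"
  assumes e: "0 < e"
  shows "integrable lborel (\<lambda>x. iexp (v \<bullet> x) * exp (- (e * norm x)\<^sup>2 / 2))"
    and "(CLINT x|lborel. iexp (v \<bullet> x) * exp (- (e * norm x)\<^sup>2 / 2))
       = (sqrt (2 * pi) / e) ^ DIM('a) * exp (- (norm v / e)\<^sup>2 / 2)"
proof -
  let ?g = "\<lambda>x. iexp (v \<bullet> x) * exp (- (e * norm x)\<^sup>2 / 2)"
  have sc: "?g (0 + (1 / e) *\<^sub>R x) = iexp ((v /\<^sub>R e) \<bullet> x) * exp (- (norm x)\<^sup>2 / 2)" for x
  proof -
    have "e * norm (0 + (1 / e) *\<^sub>R x) = norm x" "v \<bullet> (0 + (1 / e) *\<^sub>R x) = (v /\<^sub>R e) \<bullet> x"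
      using e by (simp_all add: field_simps)
    then show ?thesis by (simp only:)
  qed
  have [measurable]: "?g \<in> borel_measurable borel" by measurable
  show "integrable lborel ?g"
    using e gaussian_fourier(1)[of "v /\<^sub>R e"]
    by (subst lborel_affine_integral(2)[where c = "1 / e" and a = 0]) (simp_all only: sc, simp_all)
  have "(CLINT x|lborel. ?g x) = (1 / e) ^ DIM('a) *\<^sub>R (CLINT x|lborel. ?g (0 + (1 / e) *\<^sub>R x))"
    using e by (intro lborel_affine_integral) auto
  also have "\<dots> = (sqrt (2 * pi) / e) ^ DIM('a) * exp (- (norm v / e)\<^sup>2 / 2)"
  proof -
    have "norm (v /\<^sub>R e) = norm v / e" using e by (simp add: field_simps)
    then show ?thesis
      by (simp only: sc gaussian_fourier(2)) (simp add: scaleR_conv_of_real power_divide)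
  qed
  finally show "(CLINT x|lborel. ?g x) = (sqrt (2 * pi) / e) ^ DIM('a) * exp (- (norm v / e)\<^sup>2 / 2)" .
qed

lemma integrable_pair_product_bound:
  fixes F :: "'a::euclidean_space \<times> 'b::euclidean_space \<Rightarrow> complex" and g :: "'a \<Rightarrow> real" and h :: "'b \<Rightarrow> real"
  assumes "F \<in> borel_measurable (lborel \<Otimes>\<^sub>M lborel)" "integrable lborel g" "integrable lborel h"
    and bound: "\<And>x y. norm (F (x, y)) \<le> g x * h y"
  shows "integrable (lborel \<Otimes>\<^sub>M lborel) F"
proof -
  have [measurable]: "g \<in> borel_measurable lborel" "h \<in> borel_measurable lborel"
    using assms by (auto dest: borel_measurable_integrable)
  have "integrable (lborel \<Otimes>\<^sub>M lborel) (\<lambda>(x, y). g x * h y)"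
    using assms(2,3) by (intro lborel_pair.Fubini_integrable) (auto simp: abs_mult intro!: integrable_abs integrable_mult_left)
  then show ?thesis
  proof (rule Bochner_Integration.integrable_bound[OF _ assms(1)], intro AE_I2)
    fix z :: "'a \<times> 'b"
    show "norm (F z) \<le> norm (case z of (x, y) \<Rightarrow> g x * h y)"
      using bound[of "fst z" "snd z"] by (simp add: split_beta)
  qed
qed

section \<open>Fourier inversion for nonnegative functions\<close>

text \<open>
  Damping the inversion integral by a Gaussian makes Fubini's theorem applicable, and the inner integral
  becomes the Fourier transform of the Gaussian, centred at \<open>x\<close>. In the variable \<open>w = (y - x) / e\<close> the
  result is an average of \<open>f\<close> at scale \<open>e\<close> around \<open>x\<close> with a fixed weight.
\<close>

lemma fourier_gaussian_average:
  fixes f :: "'a::euclidean_space \<Rightarrow> real"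
  assumes f: "integrable lborel f" and [measurable]: "f \<in> borel_measurable borel" and "0 < e"
  shows "(CLINT v|lborel. iexp (- (x \<bullet> v)) * (CLINT y|lborel. f y * iexp (y \<bullet> v)) * exp (- (e * norm v)\<^sup>2 / 2))
       = sqrt (2 * pi) ^ DIM('a) * (LINT w|lborel. f (x + e *\<^sub>R w) * exp (- (norm w)\<^sup>2 / 2))"
proof -
  let ?G = "\<lambda>v. exp (- (e * norm v)\<^sup>2 / 2)"
  have "integrable lborel (\<lambda>v. norm (iexp (0 \<bullet> v) * ?G v))"
    by (intro integrable_norm gaussian_fourier_scaled \<open>0 < e\<close>)
  then have G: "integrable lborel (\<lambda>v::'a. ?G v)" by (simp add: norm_mult)
  have "(CLINT v|lborel. iexp (- (x \<bullet> v)) * (CLINT y|lborel. f y * iexp (y \<bullet> v)) * ?G v)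
      = (CLINT v|lborel. (CLINT y|lborel. f y * (iexp ((y - x) \<bullet> v) * ?G v)))"
  proof (rule Bochner_Integration.integral_cong[OF refl])
    fix v
    have "iexp (- (x \<bullet> v)) * (CLINT y|lborel. f y * iexp (y \<bullet> v)) * ?G v
        = (CLINT y|lborel. iexp (- (x \<bullet> v)) * (f y * iexp (y \<bullet> v)) * ?G v)"
      by simp
    also have "\<dots> = (CLINT y|lborel. f y * (iexp ((y - x) \<bullet> v) * ?G v))"
      by (intro Bochner_Integration.integral_cong refl)
         (simp add: inner_diff_left exp_diff exp_minus field_simps)
    finally show "iexp (- (x \<bullet> v)) * (CLINT y|lborel. f y * iexp (y \<bullet> v)) * ?G v = \<dots>" .
  qed
  also have "\<dots> = (CLINT y|lborel. (CLINT v|lborel. f y * (iexp ((y - x) \<bullet> v) * ?G v)))"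
    using integrable_norm[OF f] G
    by (intro lborel_pair.Fubini_integral integrable_pair_product_bound[where g = "\<lambda>y. norm (f y)" and h = ?G])
       (auto simp: norm_mult)
  also have "\<dots> = (CLINT y|lborel. (sqrt (2 * pi) / e) ^ DIM('a) * (f y * exp (- (norm (y - x) / e)\<^sup>2 / 2)))"
  proof (rule Bochner_Integration.integral_cong[OF refl])
    fix y
    have "(CLINT v|lborel. f y * (iexp ((y - x) \<bullet> v) * ?G v))
        = f y * (CLINT v|lborel. iexp ((y - x) \<bullet> v) * ?G v)" by simp
    then show "(CLINT v|lborel. f y * (iexp ((y - x) \<bullet> v) * ?G v))
        = (sqrt (2 * pi) / e) ^ DIM('a) * (f y * exp (- (norm (y - x) / e)\<^sup>2 / 2))"
      unfolding gaussian_fourier_scaled[OF \<open>0 < e\<close>] by simp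
  qed
  also have "\<dots> = (sqrt (2 * pi) / e) ^ DIM('a) * (LINT y|lborel. f y * exp (- (norm (y - x) / e)\<^sup>2 / 2))"
    by (simp only: integral_complex_of_real integral_mult_right_zero)
  also have "(LINT y|lborel. f y * exp (- (norm (y - x) / e)\<^sup>2 / 2))
      = e ^ DIM('a) * (LINT w|lborel. f (x + e *\<^sub>R w) * exp (- (norm w)\<^sup>2 / 2))"
    using \<open>0 < e\<close>
    by (subst lborel_affine_integral(1)[of _ e x]) (auto simp: divide_simps)
  finally show ?thesis
    using \<open>0 < e\<close> by (simp add: power_divide)
qed

text \<open>
  Let the damping in \<open>fourier_gaussian_average\<close> tend to zero. On the Fourier side dominated convergence
  applies since \<open>\<phi>\<close> is integrable. On the other side a dominating function is available only once \<open>f\<close>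
  is known to be bounded; nonnegativity provides this, since Fatou's lemma bounds \<open>f y\<close> by the lower
  limit of the Gaussian averages, and these are at most the integral of \<open>norm \<circ> \<phi>\<close>, up to constants.
\<close>

theorem fourier_inversion_nonneg:
  fixes f :: "'a::euclidean_space \<Rightarrow> real" and \<phi> :: "'a \<Rightarrow> complex"
  assumes cont: "continuous_on UNIV f" and nonneg: "\<And>x. 0 \<le> f x" and f: "integrable lborel f"
    and \<phi>: "\<And>v. \<phi> v = (CLINT y|lborel. f y * iexp (y \<bullet> v))" and int: "integrable lborel \<phi>"
  shows "(2 * pi) ^ DIM('a) * complex_of_real (f x) = (CLINT v|lborel. iexp (- (x \<bullet> v)) * \<phi> v)"
proof -
  have [measurable]: "f \<in> borel_measurable borel"
    using cont by (rule borel_measurable_continuous_onI)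
  have [measurable]: "\<phi> \<in> borel_measurable borel"
    using borel_measurable_integrable[OF int] by simp
  define d where "d = DIM('a)"
  define e where "e n = 1 / real (Suc n)" for n
  have e: "0 < e n" for n by (simp add: e_def)
  have e0: "e \<longlonglongrightarrow> 0" unfolding e_def by (rule LIMSEQ_Suc[OF lim_1_over_n])
  let ?g = "\<lambda>w::'a. exp (- (norm w)\<^sup>2 / 2)"
  have "integrable lborel (\<lambda>v. norm (iexp (0 \<bullet> v) * complex_of_real (?g v)))"
    by (intro integrable_norm gaussian_fourier)
  then have g: "integrable lborel ?g" by (simp add: norm_mult)
  have ig: "(LINT w|lborel. ?g w) = sqrt (2 * pi) ^ d"
    using gaussian_fourier(2)[of "0::'a"] unfolding d_def
    by (simp flip: of_real_power of_real_mult)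
  have sq: "sqrt (2 * pi) ^ d * sqrt (2 * pi) ^ d = (2 * pi) ^ d"
    by (simp only: power_mult_distrib[symmetric]) simp
  define R where "R n = (LINT w|lborel. f (x + e n *\<^sub>R w) * ?g w)" for n
  define A where "A n = (CLINT v|lborel. iexp (- (x \<bullet> v)) * \<phi> v * exp (- (e n * norm v)\<^sup>2 / 2))" for n
  have AR: "A = (\<lambda>n. complex_of_real (sqrt (2 * pi) ^ d * R n))"
  proof
    show "A n = complex_of_real (sqrt (2 * pi) ^ d * R n)" for n
      unfolding A_def \<phi> R_def d_def fourier_gaussian_average[OF f \<open>f \<in> _\<close> e] by simp
  qed
  have limA: "A \<longlonglongrightarrow> (CLINT v|lborel. iexp (- (x \<bullet> v)) * \<phi> v)"
    unfolding A_def
  proof (rule integral_dominated_convergence[where w = "\<lambda>v. norm (\<phi> v)"])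
    show "AE v in lborel. (\<lambda>n. iexp (- (x \<bullet> v)) * \<phi> v * exp (- (e n * norm v)\<^sup>2 / 2))
        \<longlonglongrightarrow> iexp (- (x \<bullet> v)) * \<phi> v"
    proof (rule AE_I2)
      fix v
      have "(\<lambda>n. iexp (- (x \<bullet> v)) * \<phi> v * of_real (exp (- (e n * norm v)\<^sup>2 / 2)))
        \<longlonglongrightarrow> iexp (- (x \<bullet> v)) * \<phi> v * of_real (exp (- (0 * norm v)\<^sup>2 / 2))"
        by (intro tendsto_intros e0) auto
      then show "(\<lambda>n. iexp (- (x \<bullet> v)) * \<phi> v * exp (- (e n * norm v)\<^sup>2 / 2))
        \<longlonglongrightarrow> iexp (- (x \<bullet> v)) * \<phi> v" by simp
    qed
    show "AE v in lborel. norm (iexp (- (x \<bullet> v)) * \<phi> v * exp (- (e n * norm v)\<^sup>2 / 2)) \<le> norm (\<phi> v)" for n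
      by (intro AE_I2) (auto simp: norm_mult intro!: mult_left_le)
  qed (use integrable_norm[OF int] in auto)
  have fe: "integrable lborel (\<lambda>w. f (y + e n *\<^sub>R w))" for y n
    using lborel_affine_integral(2)[of f "e n" y] f e by simp
  have lim_f: "(\<lambda>n. f (y + e n *\<^sub>R w)) \<longlonglongrightarrow> f y" for y w
  proof -
    have "(\<lambda>n. y + e n *\<^sub>R w) \<longlonglongrightarrow> y + 0 *\<^sub>R w" by (intro tendsto_intros e0)
    then show ?thesis using continuous_on_tendsto_compose[OF cont] by auto
  qed
  define C where "C = (LINT v|lborel. norm (\<phi> v))"
  have bounded: "f y * (2 * pi) ^ d \<le> C" for y
  proof -
    let ?R = "\<lambda>n. LINT w|lborel. f (y + e n *\<^sub>R w) * ?g w"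
    have int_fg: "integrable lborel (\<lambda>w. f (y + e n *\<^sub>R w) * ?g w)" for n
      by (rule Bochner_Integration.integrable_bound[OF fe[of y n]])
         (auto simp: abs_mult nonneg intro!: mult_left_le)
    have R: "ennreal (sqrt (2 * pi) ^ d) * (\<integral>\<^sup>+ w. f (y + e n *\<^sub>R w) * ?g w \<partial>lborel) \<le> ennreal C" for n
    proof -
      have "sqrt (2 * pi) ^ d * ?R n
          = norm (CLINT v|lborel. iexp (- (y \<bullet> v)) * \<phi> v * exp (- (e n * norm v)\<^sup>2 / 2))"
        unfolding \<phi> d_def fourier_gaussian_average[OF f \<open>f \<in> _\<close> e]
        by (simp add: norm_mult norm_power nonneg)
      also have "\<dots> \<le> C"
        unfolding C_def
        by (rule order_trans[OF integral_norm_bound], rule integral_mono')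
           (use int in \<open>auto simp: norm_mult intro!: mult_left_le\<close>)
      finally show ?thesis
        by (subst nn_integral_eq_integral[OF int_fg]) (auto simp: nonneg ennreal_leI simp flip: ennreal_mult)
    qed
    have "ennreal (f y * sqrt (2 * pi) ^ d) = (\<integral>\<^sup>+ w. f y * ?g w \<partial>lborel)"
      using g nonneg by (subst nn_integral_eq_integral) (auto simp: ig[simplified])
    also have "\<dots> = (\<integral>\<^sup>+ w. liminf (\<lambda>n. ennreal (f (y + e n *\<^sub>R w) * ?g w)) \<partial>lborel)"
    proof (rule nn_integral_cong)
      fix w
      have "(\<lambda>n. ennreal (f (y + e n *\<^sub>R w) * ?g w)) \<longlonglongrightarrow> ennreal (f y * ?g w)"
        by (intro tendsto_ennrealI tendsto_intros lim_f)
      then show "ennreal (f y * ?g w) = liminf (\<lambda>n. ennreal (f (y + e n *\<^sub>R w) * ?g w))"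
        by (simp add: lim_imp_Liminf)
    qed
    also have "\<dots> \<le> liminf (\<lambda>n. \<integral>\<^sup>+ w. f (y + e n *\<^sub>R w) * ?g w \<partial>lborel)"
      by (intro nn_integral_liminf) measurable
    also have "\<dots> \<le> ennreal (C / sqrt (2 * pi) ^ d)"
    proof (rule order_trans[OF Liminf_le_Limsup Limsup_bounded], simp, rule always_eventually, rule allI)
      fix n
      have "(\<integral>\<^sup>+ w. f (y + e n *\<^sub>R w) * ?g w \<partial>lborel)
          = ennreal (1 / sqrt (2 * pi) ^ d) * (ennreal (sqrt (2 * pi) ^ d) * (\<integral>\<^sup>+ w. f (y + e n *\<^sub>R w) * ?g w \<partial>lborel))"
        by (simp flip: mult.assoc ennreal_mult)
      also have "\<dots> \<le> ennreal (1 / sqrt (2 * pi) ^ d) * ennreal C"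
        by (intro mult_left_mono R) simp
      finally show "(\<integral>\<^sup>+ w. f (y + e n *\<^sub>R w) * ?g w \<partial>lborel) \<le> ennreal (C / sqrt (2 * pi) ^ d)"
        by (simp add: C_def flip: ennreal_mult)
    qed
    finally have "f y * sqrt (2 * pi) ^ d \<le> C / sqrt (2 * pi) ^ d"
      by (simp add: C_def)
    then have "f y * (sqrt (2 * pi) ^ d * sqrt (2 * pi) ^ d) \<le> C"
      by (simp add: pos_le_divide_eq mult.assoc)
    then show ?thesis
      by (simp only: sq)
  qed
  have "R \<longlonglongrightarrow> (LINT w|lborel. f x * ?g w)"
    unfolding R_def
  proof (rule integral_dominated_convergence[where w = "\<lambda>w. C / (2 * pi) ^ d * ?g w"])
    show "AE w in lborel. (\<lambda>n. f (x + e n *\<^sub>R w) * ?g w) \<longlonglongrightarrow> f x * ?g w"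
      by (intro AE_I2 tendsto_intros lim_f)
    show "AE w in lborel. norm (f (x + e n *\<^sub>R w) * ?g w) \<le> C / (2 * pi) ^ d * ?g w" for n
      using bounded by (intro AE_I2) (simp add: abs_mult nonneg pos_le_divide_eq)
  qed (use g in auto)
  then have "(\<lambda>n. complex_of_real (sqrt (2 * pi) ^ d * R n))
      \<longlonglongrightarrow> complex_of_real (sqrt (2 * pi) ^ d * (f x * sqrt (2 * pi) ^ d))"
    by (intro tendsto_intros) (simp add: ig[simplified])
  then have "(CLINT v|lborel. iexp (- (x \<bullet> v)) * \<phi> v)
      = complex_of_real (sqrt (2 * pi) ^ d * (f x * sqrt (2 * pi) ^ d))"
    using limA unfolding AR by (intro LIMSEQ_unique)
  also have "sqrt (2 * pi) ^ d * (f x * sqrt (2 * pi) ^ d) = (2 * pi) ^ d * f x"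
    by (subst mult.left_commute, subst sq, rule mult.commute)
  finally show ?thesis by (simp add: d_def)
qed

section \<open>Line integrals and orthogonal sections\<close>

text \<open>
  Insert the inversion formula for \<open>f (t *\<^sub>R u)\<close> and integrate over \<open>t\<close> first: the phase depends on \<open>v\<close>
  only through \<open>u \<bullet> v\<close>, so the one-dimensional Fourier transform of the Gaussian weight remains. Both
  sides are rewritten as nonnegative integrals, so that the limit \<open>e \<rightarrow> 0\<close> can be taken without knowing
  that \<open>f\<close> is integrable along the line.
\<close>

lemma nn_integral_line_gaussian:
  fixes f \<psi> :: "'a::euclidean_space \<Rightarrow> real"
  assumes cont: "continuous_on UNIV f" and nonneg: "\<And>x. 0 \<le> f x" and f: "integrable lborel f"
    and \<psi>: "\<And>v. (CLINT y|lborel. f y * iexp (y \<bullet> v)) = of_real (\<psi> v)"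
    and int: "integrable lborel \<psi>" and \<psi>_nonneg: "\<And>v. 0 \<le> \<psi> v" and e: "0 < e"
  shows "ennreal ((2 * pi) ^ DIM('a)) * (\<integral>\<^sup>+ t. ennreal (f (t *\<^sub>R u) * exp (- (e * t)\<^sup>2 / 2)) \<partial>lborel)
       = (\<integral>\<^sup>+ v. ennreal (\<psi> v * (sqrt (2 * pi) / e * exp (- ((u \<bullet> v) / e)\<^sup>2 / 2))) \<partial>lborel)"
proof -
  let ?G = "\<lambda>t::real. exp (- (e * t)\<^sup>2 / 2)"
  let ?F = "\<lambda>(t, v). iexp (- (t * (u \<bullet> v))) * \<psi> v * ?G t"
  have [measurable]: "\<psi> \<in> borel_measurable borel"
    using borel_measurable_integrable[OF int] by simp
  have "integrable lborel (\<lambda>t::real. norm (iexp (0 \<bullet> t) * complex_of_real (exp (- (e * norm t)\<^sup>2 / 2))))"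
    by (intro integrable_norm gaussian_fourier_scaled e)
  then have G: "integrable lborel ?G" by (simp add: norm_mult power_mult_distrib)
  have F: "integrable (lborel \<Otimes>\<^sub>M lborel) ?F"
    using \<psi>_nonneg
    by (intro integrable_pair_product_bound[OF _ G int]) (auto simp: norm_mult)
  \<comment> \<open>Integrating over \<open>v\<close> first reconstructs \<open>f\<close>; integrating over \<open>t\<close> first gives a Gaussian in \<open>u \<bullet> v\<close>.\<close>
  have inner_v: "(CLINT v|lborel. ?F (t, v)) = complex_of_real ((2 * pi) ^ DIM('a) * (f (t *\<^sub>R u) * ?G t))" for t
  proof -
    have "(CLINT v|lborel. ?F (t, v)) = (CLINT v|lborel. iexp (- ((t *\<^sub>R u) \<bullet> v)) * of_real (\<psi> v)) * ?G t"
      by (simp del: of_real_minus)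
    also have "(CLINT v|lborel. iexp (- ((t *\<^sub>R u) \<bullet> v)) * of_real (\<psi> v))
        = (2 * pi) ^ DIM('a) * complex_of_real (f (t *\<^sub>R u))"
      using int by (intro fourier_inversion_nonneg[symmetric, OF cont nonneg f]) (auto simp: \<psi>)
    finally show ?thesis by simp
  qed
  have inner_t: "(CLINT t|lborel. ?F (t, v))
      = complex_of_real (\<psi> v * (sqrt (2 * pi) / e * exp (- ((u \<bullet> v) / e)\<^sup>2 / 2)))" for v
  proof -
    have "(CLINT t|lborel. ?F (t, v))
        = (CLINT t|lborel. \<psi> v * (iexp ((- (u \<bullet> v)) \<bullet> t) * exp (- (e * norm t)\<^sup>2 / 2)))"
      by (intro Bochner_Integration.integral_cong refl) (simp add: power_mult_distrib mult_ac)
    also have "\<dots> = \<psi> v * (CLINT t|lborel. iexp ((- (u \<bullet> v)) \<bullet> t) * exp (- (e * norm t)\<^sup>2 / 2))"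
      by (rule integral_mult_right_zero)
    also have "\<dots> = complex_of_real (\<psi> v * (sqrt (2 * pi) / e * exp (- ((u \<bullet> v) / e)\<^sup>2 / 2)))"
      unfolding gaussian_fourier_scaled(2)[OF e] by (simp add: power_divide)
    finally show ?thesis .
  qed
  have intL: "integrable lborel (\<lambda>t. (2 * pi) ^ DIM('a) * (f (t *\<^sub>R u) * ?G t))"
  proof -
    have "integrable lborel (\<lambda>t. CLINT v|lborel. ?F (t, v))"
      using lborel_pair.integrable_fst[OF F] by (simp only: prod.case)
    then show ?thesis unfolding inner_v complex_of_real_integrable_eq .
  qed
  have intR: "integrable lborel (\<lambda>v. \<psi> v * (sqrt (2 * pi) / e * exp (- ((u \<bullet> v) / e)\<^sup>2 / 2)))"
  proof -
    have "integrable lborel (\<lambda>v. CLINT t|lborel. ?F (t, v))"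
      using lborel_pair.integrable_snd[OF F] by (simp only: prod.case)
    then show ?thesis unfolding inner_t complex_of_real_integrable_eq .
  qed
  have "complex_of_real (LINT t|lborel. (2 * pi) ^ DIM('a) * (f (t *\<^sub>R u) * ?G t))
      = (CLINT t|lborel. (CLINT v|lborel. ?F (t, v)))"
    unfolding inner_v by (rule integral_complex_of_real[symmetric])
  also have "\<dots> = (CLINT v|lborel. (CLINT t|lborel. ?F (t, v)))"
    using lborel_pair.Fubini_integral[OF F] by simp
  also have "\<dots> = complex_of_real (LINT v|lborel. \<psi> v * (sqrt (2 * pi) / e * exp (- ((u \<bullet> v) / e)\<^sup>2 / 2)))"
    unfolding inner_t by (rule integral_complex_of_real)
  finally have eq: "(LINT t|lborel. (2 * pi) ^ DIM('a) * (f (t *\<^sub>R u) * ?G t))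
      = (LINT v|lborel. \<psi> v * (sqrt (2 * pi) / e * exp (- ((u \<bullet> v) / e)\<^sup>2 / 2)))"
    by (simp only: of_real_eq_iff)
  have [measurable]: "f \<in> borel_measurable borel"
    using cont by (rule borel_measurable_continuous_onI)
  have "ennreal ((2 * pi) ^ DIM('a)) * (\<integral>\<^sup>+ t. ennreal (f (t *\<^sub>R u) * ?G t) \<partial>lborel)
      = (\<integral>\<^sup>+ t. ennreal ((2 * pi) ^ DIM('a) * (f (t *\<^sub>R u) * ?G t)) \<partial>lborel)"
    by (subst nn_integral_cmult[symmetric]) (auto simp: nonneg simp flip: ennreal_mult)
  also have "\<dots> = ennreal (LINT t|lborel. (2 * pi) ^ DIM('a) * (f (t *\<^sub>R u) * ?G t))"
    using nonneg by (intro nn_integral_eq_integral intL) auto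
  also have "\<dots> = (\<integral>\<^sup>+ v. ennreal (\<psi> v * (sqrt (2 * pi) / e * exp (- ((u \<bullet> v) / e)\<^sup>2 / 2))) \<partial>lborel)"
    unfolding eq using \<psi>_nonneg e by (intro nn_integral_eq_integral[symmetric] intR) auto
  finally show ?thesis .
qed

text \<open>
  Splitting the right side of \<open>nn_integral_line_gaussian\<close> along \<open>u\<close> and substituting \<open>e s\<close> for the
  coordinate \<open>s = u \<bullet> v\<close> gives a Gaussian average of \<open>H (e s)\<close>, where \<open>H s\<close> is the integral of \<open>\<psi>\<close>
  over the hyperplane at height \<open>s\<close>. As \<open>e\<close> tends to zero this tends to a multiple of \<open>H 0\<close>. The bound on
  \<open>\<psi>\<close> decreases with the norm, which is smallest at height \<open>0\<close>; so its restriction to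
  \<open>u\<^sup>\<bottom>\<close> dominates \<open>\<psi>\<close> on all parallel hyperplanes at once.
\<close>

theorem nn_integral_line_eq_orthogonal_section:
  fixes f \<psi> :: "'a::euclidean_space \<Rightarrow> real"
  assumes cont: "continuous_on UNIV f" and nonneg: "\<And>x. 0 \<le> f x" and f: "integrable lborel f"
    and \<psi>: "\<And>v. (CLINT y|lborel. f y * iexp (y \<bullet> v)) = of_real (\<psi> v)"
    and \<psi>_cont: "continuous_on UNIV \<psi>" and \<psi>_nonneg: "\<And>v. 0 \<le> \<psi> v"
    and bound: "\<And>v. \<psi> v \<le> exp (- ((c * norm v) powr \<alpha>))" and "0 < c" "0 < \<alpha>"
    and u: "norm u = 1"
  shows "ennreal ((2 * pi) ^ (DIM('a) - 1)) * (\<integral>\<^sup>+ t. ennreal (f (t *\<^sub>R u)) \<partial>lborel)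
       = (\<integral>\<^sup>+ y. ennreal (\<psi> y) \<partial>subspace_lborel ({u}\<^sup>\<bottom>))"
proof -
  interpret L: homogeneous_measure "lborel :: 'a measure" "DIM('a)" by (rule homogeneous_measure_lborel)
  let ?W = "subspace_lborel ({u}\<^sup>\<bottom>)"
  interpret W: homogeneous_measure ?W "DIM('a) - 1"
    by (rule homogeneous_measure_subspace_lborel[OF u])
  have [measurable]: "f \<in> borel_measurable borel" "\<psi> \<in> borel_measurable borel"
    using cont \<psi>_cont by (auto intro: borel_measurable_continuous_onI)
  have int: "integrable lborel \<psi>"
  proof (rule integrableI_bounded)
    have "(\<integral>\<^sup>+ v. ennreal (norm (\<psi> v)) \<partial>lborel) \<le> (\<integral>\<^sup>+ v. ennreal (exp (- ((c * norm (v::'a)) powr \<alpha>))) \<partial>lborel)"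
    proof (rule nn_integral_mono)
      show "ennreal (norm (\<psi> v)) \<le> ennreal (exp (- ((c * norm v) powr \<alpha>)))" for v
        using bound[of v] \<psi>_nonneg[of v] by (intro ennreal_leI) (simp only: real_norm_def abs_of_nonneg)
    qed
    also have "\<dots> < \<infinity>"
      using \<open>0 < \<alpha>\<close> \<open>0 < c\<close> by (rule L.nn_integral_exp_norm_finite)
    finally show "(\<integral>\<^sup>+ v. ennreal (norm (\<psi> v)) \<partial>lborel) < \<infinity>" .
  qed simp
  define e where "e n = 1 / real (Suc n)" for n
  have e: "0 < e n" for n by (simp add: e_def)
  have e0: "e \<longlonglongrightarrow> 0" unfolding e_def by (rule LIMSEQ_Suc[OF lim_1_over_n])
  define H where "H s = (\<integral>\<^sup>+ y. ennreal (\<psi> (s *\<^sub>R u + y)) \<partial>?W)" for s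
  have [measurable]: "H \<in> borel_measurable borel"
    unfolding H_def by measurable
  define w where "w y = ennreal (exp (- ((c * norm y) powr \<alpha>)))" for y :: 'a
  have [measurable]: "w \<in> borel_measurable borel" unfolding w_def by measurable
  have w_finite: "(\<integral>\<^sup>+ y. w y \<partial>?W) < \<infinity>"
    unfolding w_def using \<open>0 < \<alpha>\<close> \<open>0 < c\<close> by (rule W.nn_integral_exp_norm_finite)
  have dom: "AE y in ?W. ennreal (\<psi> (s *\<^sub>R u + y)) \<le> w y" for s
    using AE_subspace_lborel_orthogonal_comp[of u]
  proof eventually_elim
    case (elim y)
    have "(norm y)\<^sup>2 \<le> (norm (s *\<^sub>R u + y))\<^sup>2"
      using elim norm_add_Pythagorean[of "s *\<^sub>R u" y] by (simp add: orthogonal_def)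
    then have "norm y \<le> norm (s *\<^sub>R u + y)"
      by (rule power2_le_imp_le) simp
    then have "(c * norm y) powr \<alpha> \<le> (c * norm (s *\<^sub>R u + y)) powr \<alpha>"
      using \<open>0 < c\<close> \<open>0 < \<alpha>\<close> by (intro powr_mono2) auto
    then show ?case
      unfolding w_def using bound[of "s *\<^sub>R u + y"] by (intro ennreal_leI) (smt (verit) exp_le_cancel_iff)
  qed
  have HW: "H s \<le> (\<integral>\<^sup>+ y. w y \<partial>?W)" for s
    unfolding H_def by (rule nn_integral_mono_AE[OF dom])
  have H_lim: "(\<lambda>n. H (e n * s)) \<longlonglongrightarrow> H 0" for s
    unfolding H_def
  proof (rule nn_integral_dominated_convergence[where w = w])
    show "AE y in ?W. (\<lambda>n. ennreal (\<psi> ((e n * s) *\<^sub>R u + y))) \<longlonglongrightarrow> ennreal (\<psi> (0 *\<^sub>R u + y))"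
    proof (intro AE_I2 tendsto_ennrealI)
      fix y
      have "(\<lambda>n. (e n * s) *\<^sub>R u + y) \<longlonglongrightarrow> (0 * s) *\<^sub>R u + y"
        by (intro tendsto_intros e0)
      then show "(\<lambda>n. \<psi> ((e n * s) *\<^sub>R u + y)) \<longlonglongrightarrow> \<psi> (0 *\<^sub>R u + y)"
        using continuous_on_tendsto_compose[OF \<psi>_cont] by auto
    qed
  qed (use dom w_finite in auto)
  have step: "ennreal ((2 * pi) ^ DIM('a)) * (\<integral>\<^sup>+ t. ennreal (f (t *\<^sub>R u) * exp (- (e n * t)\<^sup>2 / 2)) \<partial>lborel)
      = ennreal (sqrt (2 * pi)) * (\<integral>\<^sup>+ s. ennreal (exp (- s\<^sup>2 / 2)) * H (e n * s) \<partial>lborel)" for n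
  proof -
    let ?K = "\<lambda>s. sqrt (2 * pi) / e n * exp (- (s / e n)\<^sup>2 / 2)"
    have "ennreal ((2 * pi) ^ DIM('a)) * (\<integral>\<^sup>+ t. ennreal (f (t *\<^sub>R u) * exp (- (e n * t)\<^sup>2 / 2)) \<partial>lborel)
        = (\<integral>\<^sup>+ v. ennreal (\<psi> v * ?K (u \<bullet> v)) \<partial>lborel)"
      by (rule nn_integral_line_gaussian[OF cont nonneg f \<psi> int \<psi>_nonneg e])
    also have "\<dots> = (\<integral>\<^sup>+ s. (\<integral>\<^sup>+ y. ennreal (\<psi> (s *\<^sub>R u + y) * ?K (u \<bullet> (s *\<^sub>R u + y))) \<partial>?W) \<partial>lborel)"
      by (intro nn_integral_lborel_orthogonal_split[OF u]) measurable
    also have "\<dots> = (\<integral>\<^sup>+ s. ennreal (?K s) * H s \<partial>lborel)"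
    proof (rule nn_integral_cong)
      fix s
      have "(\<integral>\<^sup>+ y. ennreal (\<psi> (s *\<^sub>R u + y) * ?K (u \<bullet> (s *\<^sub>R u + y))) \<partial>?W)
          = (\<integral>\<^sup>+ y. ennreal (?K s) * ennreal (\<psi> (s *\<^sub>R u + y)) \<partial>?W)"
      proof (rule nn_integral_cong_AE)
        show "AE y in ?W. ennreal (\<psi> (s *\<^sub>R u + y) * ?K (u \<bullet> (s *\<^sub>R u + y)))
            = ennreal (?K s) * ennreal (\<psi> (s *\<^sub>R u + y))"
          using AE_subspace_lborel_orthogonal_comp[of u]
        proof eventually_elim
          case (elim y)
          then have "u \<bullet> (s *\<^sub>R u + y) = s" using u by (simp add: inner_add_right norm_eq_1)
          then show ?case
            using e[of n] \<psi>_nonneg by (simp only: mult.commute[of "\<psi> _"]) (subst ennreal_mult, auto)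
        qed
      qed
      then show "(\<integral>\<^sup>+ y. ennreal (\<psi> (s *\<^sub>R u + y) * ?K (u \<bullet> (s *\<^sub>R u + y))) \<partial>?W) = ennreal (?K s) * H s"
        by (simp add: nn_integral_cmult H_def)
    qed
    also have "\<dots> = \<bar>e n\<bar> * (\<integral>\<^sup>+ s. ennreal (?K (0 + e n * s)) * H (0 + e n * s) \<partial>lborel)"
      using e[of n] by (intro nn_integral_real_affine) auto
    also have "\<dots> = (\<integral>\<^sup>+ s. ennreal (e n) * (ennreal (?K (0 + e n * s)) * H (0 + e n * s)) \<partial>lborel)"
      using e[of n] by (subst nn_integral_cmult) auto
    also have "\<dots> = (\<integral>\<^sup>+ s. ennreal (sqrt (2 * pi)) * (ennreal (exp (- s\<^sup>2 / 2)) * H (e n * s)) \<partial>lborel)"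
    proof (rule nn_integral_cong)
      fix s
      have "e n * ?K (0 + e n * s) = sqrt (2 * pi) * exp (- s\<^sup>2 / 2)"
        using e[of n] by simp
      then have "ennreal (e n) * ennreal (?K (0 + e n * s)) = ennreal (sqrt (2 * pi)) * ennreal (exp (- s\<^sup>2 / 2))"
        using e[of n] by (simp only: ennreal_mult'[symmetric] less_imp_le real_sqrt_ge_zero pi_ge_zero) (simp flip: ennreal_mult)
      then show "ennreal (e n) * (ennreal (?K (0 + e n * s)) * H (0 + e n * s))
          = ennreal (sqrt (2 * pi)) * (ennreal (exp (- s\<^sup>2 / 2)) * H (e n * s))"
        by (simp only: mult.assoc[symmetric] add_0)
    qed
    also have "\<dots> = ennreal (sqrt (2 * pi)) * (\<integral>\<^sup>+ s. ennreal (exp (- s\<^sup>2 / 2)) * H (e n * s) \<partial>lborel)"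
      by (intro nn_integral_cmult) measurable
    finally show ?thesis .
  qed
  have limL: "(\<lambda>n. ennreal ((2 * pi) ^ DIM('a)) * (\<integral>\<^sup>+ t. ennreal (f (t *\<^sub>R u) * exp (- (e n * t)\<^sup>2 / 2)) \<partial>lborel))
      \<longlonglongrightarrow> ennreal ((2 * pi) ^ DIM('a)) * (\<integral>\<^sup>+ t. ennreal (f (t *\<^sub>R u)) \<partial>lborel)"
  proof (intro ennreal_tendsto_cmult nn_integral_LIMSEQ)
    show "incseq (\<lambda>n t. ennreal (f (t *\<^sub>R u) * exp (- (e n * t)\<^sup>2 / 2)))"
    proof (intro incseq_SucI le_funI ennreal_leI mult_left_mono nonneg)
      fix n t
      have "(e (Suc n) * t)\<^sup>2 \<le> (e n * t)\<^sup>2"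
        using e[of "Suc n"] unfolding power_mult_distrib
        by (intro mult_right_mono power_mono) (auto simp: e_def field_simps)
      then show "exp (- (e n * t)\<^sup>2 / 2) \<le> exp (- (e (Suc n) * t)\<^sup>2 / 2)" by simp
    qed
    fix t
    have "(\<lambda>n. f (t *\<^sub>R u) * exp (- (e n * t)\<^sup>2 / 2)) \<longlonglongrightarrow> f (t *\<^sub>R u) * exp (- (0 * t)\<^sup>2 / 2)"
      by (intro tendsto_intros e0) auto
    then show "(\<lambda>n. ennreal (f (t *\<^sub>R u) * exp (- (e n * t)\<^sup>2 / 2))) \<longlonglongrightarrow> ennreal (f (t *\<^sub>R u))"
      by (intro tendsto_ennrealI) simp
  qed auto
  have limR: "(\<lambda>n. ennreal (sqrt (2 * pi)) * (\<integral>\<^sup>+ s. ennreal (exp (- s\<^sup>2 / 2)) * H (e n * s) \<partial>lborel))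
      \<longlonglongrightarrow> ennreal (sqrt (2 * pi)) * (\<integral>\<^sup>+ s. ennreal (exp (- s\<^sup>2 / 2)) * H 0 \<partial>lborel)"
  proof (intro ennreal_tendsto_cmult nn_integral_dominated_convergence[where w = "\<lambda>s. ennreal (exp (- s\<^sup>2 / 2)) * (\<integral>\<^sup>+ y. w y \<partial>?W)"])
    show "AE s in lborel. ennreal (exp (- s\<^sup>2 / 2)) * H (e n * s) \<le> ennreal (exp (- s\<^sup>2 / 2)) * (\<integral>\<^sup>+ y. w y \<partial>?W)" for n
      by (intro AE_I2 mult_left_mono HW) simp
    show "(\<integral>\<^sup>+ s. ennreal (exp (- s\<^sup>2 / 2)) * (\<integral>\<^sup>+ y. w y \<partial>?W) \<partial>lborel) < \<infinity>"
      using w_finite nn_integral_gaussian by (subst nn_integral_multc) (auto simp: ennreal_mult_less_top)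
    show "AE s in lborel. (\<lambda>n. ennreal (exp (- s\<^sup>2 / 2)) * H (e n * s)) \<longlonglongrightarrow> ennreal (exp (- s\<^sup>2 / 2)) * H 0"
      by (intro AE_I2 ennreal_tendsto_cmult H_lim) simp
  qed auto
  have "ennreal ((2 * pi) ^ DIM('a)) * (\<integral>\<^sup>+ t. ennreal (f (t *\<^sub>R u)) \<partial>lborel)
      = ennreal (sqrt (2 * pi)) * (\<integral>\<^sup>+ s. ennreal (exp (- s\<^sup>2 / 2)) * H 0 \<partial>lborel)"
    using limL limR unfolding step by (rule LIMSEQ_unique)
  also have "\<dots> = ennreal (sqrt (2 * pi)) * (ennreal (sqrt (2 * pi)) * H 0)"
    by (subst nn_integral_multc) (auto simp: nn_integral_gaussian[simplified])
  also have "\<dots> = ennreal (2 * pi) * H 0"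
    by (simp add: mult.assoc[symmetric] flip: ennreal_mult)
  also have "ennreal ((2 * pi) ^ DIM('a)) = ennreal (2 * pi) * ennreal ((2 * pi) ^ (DIM('a) - 1))"
  proof -
    have "(2 * pi) ^ DIM('a) = (2 * pi) * (2 * pi) ^ (DIM('a) - 1)"
      using power_minus_mult[of "DIM('a)" "2 * pi"] by (simp only: DIM_positive mult.commute)
    then show ?thesis
      by (simp only:) (rule ennreal_mult, simp_all)
  qed
  finally have "ennreal (2 * pi) * (ennreal ((2 * pi) ^ (DIM('a) - 1)) * (\<integral>\<^sup>+ t. ennreal (f (t *\<^sub>R u)) \<partial>lborel))
      = ennreal (2 * pi) * H 0"
    by (simp only: mult.assoc)
  then show ?thesis
    by (simp add: ennreal_mult_cancel_left H_def)
qed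

section \<open>The spectral norm of a law with a density\<close>

lemma spectral_norm_nonneg: "0 \<le> spectral_norm \<alpha> \<sigma> x"
  unfolding spectral_norm_def by (rule powr_ge_zero)

lemma spectral_norm_scaleR:
  assumes "\<alpha> \<noteq> 0"
  shows "spectral_norm \<alpha> \<sigma> (c *\<^sub>R x) = \<bar>c\<bar> * spectral_norm \<alpha> \<sigma> x"
proof -
  have "(LINT z|\<sigma>. \<bar>c *\<^sub>R x \<bullet> z\<bar> powr \<alpha>) = \<bar>c\<bar> powr \<alpha> * (LINT z|\<sigma>. \<bar>x \<bullet> z\<bar> powr \<alpha>)"
    by (simp add: abs_mult powr_mult)
  moreover have "0 \<le> (LINT z|\<sigma>. \<bar>x \<bullet> z\<bar> powr \<alpha>)"
    by (rule Bochner_Integration.integral_nonneg) simp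
  ultimately show ?thesis
    unfolding spectral_norm_def using assms by (simp add: powr_mult powr_powr)
qed

lemma continuous_characteristic_function:
  fixes M :: "'a::euclidean_space measure"
  assumes "prob_space M" and [measurable_cong]: "sets M = sets borel"
  shows "continuous_on UNIV (\<lambda>v. CLINT x|M. iexp (x \<bullet> v))"
proof -
  interpret prob_space M by fact
  show ?thesis
    unfolding continuous_on_sequentially
  proof (intro allI ballI impI, elim conjE)
    fix s :: "nat \<Rightarrow> 'a" and v assume s: "s \<longlonglongrightarrow> v"
    show "((\<lambda>v. CLINT x|M. iexp (x \<bullet> v)) \<circ> s) \<longlonglongrightarrow> (CLINT x|M. iexp (x \<bullet> v))"
      unfolding o_def
    proof (rule integral_dominated_convergence[where w = "\<lambda>_. 1"])
      show "AE x in M. (\<lambda>i. iexp (x \<bullet> s i)) \<longlonglongrightarrow> iexp (x \<bullet> v)"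
        by (intro AE_I2 tendsto_intros s)
    qed auto
  qed
qed

text \<open>
  The spectral norm is recovered from the characteristic function by taking the logarithm, so
  it inherits the continuity of the latter.
\<close>

lemma continuous_spectral_norm:
  fixes M :: "'a::euclidean_space measure"
  assumes "prob_space M" "sets M = sets borel" and "0 < \<alpha>" and "spectral_measure \<alpha> M \<sigma>"
  shows "continuous_on UNIV (spectral_norm \<alpha> \<sigma>)"
proof -
  have char: "(CLINT x|M. iexp (x \<bullet> v)) = of_real (exp (- (spectral_norm \<alpha> \<sigma> v powr \<alpha>)))" for v
    using assms(4) unfolding spectral_measure_def by blast
  have "continuous_on UNIV (\<lambda>v. Re (of_real (exp (- (spectral_norm \<alpha> \<sigma> v powr \<alpha>)))))"
    using continuous_on_Re[OF continuous_characteristic_function[OF assms(1,2)]] unfolding char .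
  then have "continuous_on UNIV (\<lambda>v. - ln (exp (- (spectral_norm \<alpha> \<sigma> v powr \<alpha>))))"
    unfolding Re_complex_of_real by (intro continuous_on_minus continuous_on_ln) auto
  then have "continuous_on UNIV (\<lambda>v. spectral_norm \<alpha> \<sigma> v powr \<alpha>)"
    by simp
  then have "continuous_on UNIV (\<lambda>v. (spectral_norm \<alpha> \<sigma> v powr \<alpha>) powr (1 / \<alpha>))"
    by (rule continuous_on_powr'[OF _ continuous_on_const]) (use \<open>0 < \<alpha>\<close> in auto)
  then show ?thesis
    using \<open>0 < \<alpha>\<close> by (simp add: powr_powr spectral_norm_nonneg)
qed

lemma AE_density_inner_notin_countable:
  fixes f :: "'a::euclidean_space \<Rightarrow> real"
  assumes [measurable]: "f \<in> borel_measurable borel" and "x \<noteq> 0" "countable R"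
  shows "AE y in density lborel (\<lambda>y. ennreal (f y)). x \<bullet> y \<notin> R"
proof -
  have "AE y in lborel. x \<bullet> y \<noteq> r" for r
  proof -
    have "{y. x \<bullet> y = r} \<in> null_sets lebesgue"
      using negligible_hyperplane[of x r] \<open>x \<noteq> 0\<close> by (simp add: negligible_iff_null_sets)
    then have "{y. x \<bullet> y = r} \<in> null_sets lborel"
      by (subst (asm) null_sets_completion_iff) auto
    then show ?thesis
      by (auto dest: AE_not_in)
  qed
  then have "AE y in lborel. \<forall>r\<in>R. x \<bullet> y \<noteq> r"
    using \<open>countable R\<close> by (simp add: AE_ball_countable)
  then show ?thesis
    by (subst AE_density) (auto elim: eventually_mono)
qed

text \<open>
  A characteristic function reaches the value \<open>1\<close> at \<open>x\<close> only if \<open>cos (y \<bullet> x) = 1\<close> almost surely. Then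
  \<open>y \<bullet> x\<close> is almost surely a multiple of \<open>2 * pi\<close>, so the law lives on countably many hyperplanes,
  which have Lebesgue measure zero unless \<open>x = 0\<close>.
\<close>

lemma char_eq_one_imp_zero:
  fixes f :: "'a::euclidean_space \<Rightarrow> real"
  assumes [measurable]: "f \<in> borel_measurable borel" and M: "M = density lborel (\<lambda>x. ennreal (f x))"
    and "prob_space M" and one: "(CLINT y|M. iexp (y \<bullet> x)) = 1"
  shows "x = 0"
proof (rule ccontr)
  assume "x \<noteq> 0"
  interpret prob_space M by fact
  have [measurable_cong]: "sets M = sets borel" by (simp add: M)
  have int: "integrable M (\<lambda>y. iexp (y \<bullet> x))"
    by (rule integrable_const_bound[of _ 1]) auto
  have cos: "integrable M (\<lambda>y. cos (y \<bullet> x))"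
    by (rule integrable_const_bound[of _ 1]) auto
  have "(LINT y|M. cos (y \<bullet> x)) = Re (CLINT y|M. iexp (y \<bullet> x))"
    using integral_Re[OF int] by (simp add: Re_exp)
  then have "(LINT y|M. 1 - cos (y \<bullet> x)) = 0"
    using cos one by (simp add: prob_space)
  then have "AE y in M. 1 - cos (y \<bullet> x) = 0"
    using cos by (subst (asm) integral_nonneg_eq_0_iff_AE) auto
  moreover have "AE y in M. x \<bullet> y \<notin> range (\<lambda>n::int. of_int n * 2 * pi)"
    unfolding M using \<open>x \<noteq> 0\<close> by (intro AE_density_inner_notin_countable) auto
  ultimately have "AE y in M. False"
    by eventually_elim (auto simp: cos_one_2pi_int inner_commute)
  then show False by (simp add: AE_False)
qed

lemma homogeneous_lower_bound:
  fixes p :: "'a::euclidean_space \<Rightarrow> real"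
  assumes cont: "continuous_on UNIV p" and hom: "\<And>c x. p (c *\<^sub>R x) = \<bar>c\<bar> * p x"
    and pos: "\<And>x. x \<noteq> 0 \<Longrightarrow> 0 < p x"
  obtains c where "0 < c" "\<And>x. c * norm x \<le> p x"
proof -
  obtain b :: 'a where b: "b \<in> Basis" using nonempty_Basis by blast
  then have "sphere (0::'a) 1 \<noteq> {}" by (auto intro!: exI[of _ b])
  then obtain z where z: "z \<in> sphere 0 1" "\<And>x. x \<in> sphere 0 1 \<Longrightarrow> p z \<le> p x"
    using continuous_attains_inf[OF compact_sphere _ continuous_on_subset[OF cont]] by (metis subset_UNIV)
  have "p z * norm x \<le> p x" for x
  proof (cases "x = 0")
    case True
    then show ?thesis using hom[of 0 x] by simp
  next
    case False
    then have "p z \<le> p (x /\<^sub>R norm x)" by (intro z) simp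
    then show ?thesis using False by (simp add: hom field_simps)
  qed
  moreover have "0 < p z" using z(1) by (intro pos) auto
  ultimately show ?thesis using that by blast
qed

section \<open>Line integrals of stable densities\<close>

theorem theorem6p15:
  fixes \<alpha> :: real
    and M :: "'a::euclidean_space measure"
    and f :: "'a \<Rightarrow> real"
    and F :: "'a set"
    and u :: 'a
  assumes "0 < \<alpha>" and "\<alpha> \<le> 2"
    and "symmetric_stable \<alpha> M"
    and "associated_star_body \<alpha> M F"
    and "continuous_on UNIV f" and "\<And>x. 0 \<le> f x"
    and "M = density lborel (\<lambda>x. ennreal (f x))"
    and "norm u = 1"
  shows "F \<inter> {u}\<^sup>\<bottom> \<in> fmeasurable (subspace_lborel ({u}\<^sup>\<bottom>)) \<and>
         integrable lborel (\<lambda>t. f (t *\<^sub>R u)) \<and>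
         (LINT t|lborel. f (t *\<^sub>R u)) =
           1 / (2 * pi) ^ (DIM('a) - 1) * Gamma (1 + (real DIM('a) - 1) / \<alpha>)
             * measure (subspace_lborel ({u}\<^sup>\<bottom>)) (F \<inter> {u}\<^sup>\<bottom>)"
proof -
  have M: "prob_space M" "sets M = sets borel"
    using assms(3) unfolding symmetric_stable_def by auto
  obtain \<sigma> where \<sigma>: "spectral_measure \<alpha> M \<sigma>" and F: "F = {x. spectral_norm \<alpha> \<sigma> x \<le> 1}"
    using assms(4) unfolding associated_star_body_def by blast
  define p where "p = spectral_norm \<alpha> \<sigma>"
  have hom: "p (c *\<^sub>R x) = \<bar>c\<bar> * p x" for c x
    unfolding p_def using \<open>0 < \<alpha>\<close> by (intro spectral_norm_scaleR) simp
  have p_nonneg: "0 \<le> p x" for x unfolding p_def by (rule spectral_norm_nonneg)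
  have p_cont: "continuous_on UNIV p"
    unfolding p_def using M \<open>0 < \<alpha>\<close> \<sigma> by (rule continuous_spectral_norm)
  have [measurable]: "p \<in> borel_measurable borel" "f \<in> borel_measurable borel"
    using p_cont assms(5) by (auto intro: borel_measurable_continuous_onI)
  have char: "(CLINT x|M. iexp (x \<bullet> v)) = of_real (exp (- (p v powr \<alpha>)))" for v
    using \<sigma> unfolding spectral_measure_def p_def by blast
  have p_pos: "0 < p x" if "x \<noteq> 0" for x
  proof -
    have "p x \<noteq> 0"
      using char_eq_one_imp_zero[OF _ assms(7) M(1), of x] char[of x] that by auto
    then show ?thesis using p_nonneg[of x] by simp
  qed
  obtain c where c: "0 < c" "\<And>x. c * norm x \<le> p x"
    using homogeneous_lower_bound[OF p_cont hom p_pos] by blast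
  have "(\<integral>\<^sup>+ x. ennreal (f x) \<partial>lborel) = 1"
    using prob_space.emeasure_space_1[OF M(1)] by (simp add: assms(7) emeasure_density)
  then have f_int: "integrable lborel f"
    using assms(6) by (intro integrableI_nonneg) auto
  have char': "(CLINT y|lborel. f y * iexp (y \<bullet> v)) = of_real (exp (- (p v powr \<alpha>)))" for v
    unfolding char[symmetric] assms(7) using assms(6)
    by (subst integral_density) (auto simp: scaleR_conv_of_real)

  let ?W = "subspace_lborel ({u}\<^sup>\<bottom>)"
  interpret W: homogeneous_measure ?W "DIM('a) - 1"
    by (rule homogeneous_measure_subspace_lborel[OF assms(8)])
  have F_meas: "F \<in> sets borel" unfolding F p_def[symmetric] by measurable
  have "F \<subseteq> cball 0 (1 / c)"
  proof
    fix x assume "x \<in> F"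
    then have "c * norm x \<le> 1" using c(2)[of x] by (simp add: F p_def)
    then show "x \<in> cball 0 (1 / c)" using c(1) by (simp add: pos_le_divide_eq mult.commute)
  qed
  then have F_fin: "emeasure ?W F < \<infinity>"
    by (intro W.finite_bounded[OF F_meas] bounded_subset[OF bounded_cball])
  have perp_meas: "{u}\<^sup>\<bottom> \<in> sets borel"
    by (intro borel_closed closed_subspace subspace_orthogonal_comp)
  have F_eq: "emeasure ?W (F \<inter> {u}\<^sup>\<bottom>) = emeasure ?W F"
  proof (rule emeasure_eq_AE)
    show "AE x in ?W. x \<in> F \<inter> {u}\<^sup>\<bottom> \<longleftrightarrow> x \<in> F"
      using AE_subspace_lborel_orthogonal_comp[of u]
      by eventually_elim (auto simp: orthogonal_comp_def orthogonal_def)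
  qed (use F_meas perp_meas in auto)
  have fm: "F \<inter> {u}\<^sup>\<bottom> \<in> fmeasurable ?W"
    using F_fin F_meas perp_meas F_eq by (intro fmeasurableI) auto

  have "0 \<le> (real DIM('a) - 1) / \<alpha>"
    using \<open>0 < \<alpha>\<close> DIM_positive[where 'a = 'a] by (intro divide_nonneg_pos) linarith+
  then have Gamma_nonneg: "0 \<le> Gamma (1 + (real DIM('a) - 1) / \<alpha>)"
    by (intro Gamma_real_nonneg) linarith
  have "ennreal ((2 * pi) ^ (DIM('a) - 1)) * (\<integral>\<^sup>+ t. ennreal (f (t *\<^sub>R u)) \<partial>lborel)
      = (\<integral>\<^sup>+ y. ennreal (exp (- (p y powr \<alpha>))) \<partial>?W)"
  proof (rule nn_integral_line_eq_orthogonal_section[OF assms(5,6) f_int char' _ _ _ c(1) \<open>0 < \<alpha>\<close> assms(8)])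
    show "continuous_on UNIV (\<lambda>v. exp (- (p v powr \<alpha>)))"
      using p_cont p_nonneg \<open>0 < \<alpha>\<close> by (intro continuous_intros continuous_on_powr') auto
    show "exp (- (p v powr \<alpha>)) \<le> exp (- ((c * norm v) powr \<alpha>))" for v
      using c p_nonneg \<open>0 < \<alpha>\<close> by (auto intro!: powr_mono2)
  qed simp
  also have "\<dots> = ennreal (Gamma (1 + real (DIM('a) - 1) / \<alpha>)) * emeasure ?W F"
    unfolding F p_def[symmetric] using hom \<open>0 < \<alpha>\<close> p_nonneg by (intro W.nn_integral_exp_gauge) auto
  also have "\<dots> = ennreal (Gamma (1 + (real DIM('a) - 1) / \<alpha>) * measure ?W (F \<inter> {u}\<^sup>\<bottom>))"
    using fm Gamma_nonneg
    by (simp add: F_eq[symmetric] emeasure_eq_measure2 fmeasurableD2 ennreal_mult of_nat_diff Suc_leI)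
  finally have main: "ennreal ((2 * pi) ^ (DIM('a) - 1)) * (\<integral>\<^sup>+ t. ennreal (f (t *\<^sub>R u)) \<partial>lborel)
      = ennreal (Gamma (1 + (real DIM('a) - 1) / \<alpha>) * measure ?W (F \<inter> {u}\<^sup>\<bottom>))" .
  have "(\<integral>\<^sup>+ t. ennreal (f (t *\<^sub>R u)) \<partial>lborel) < \<infinity>"
  proof -
    have "ennreal ((2 * pi) ^ (DIM('a) - 1)) \<noteq> 0" by simp
    moreover have "ennreal ((2 * pi) ^ (DIM('a) - 1)) * (\<integral>\<^sup>+ t. ennreal (f (t *\<^sub>R u)) \<partial>lborel) < top"
      unfolding main by simp
    ultimately show ?thesis
      unfolding ennreal_mult_less_top by auto
  qed
  then have int: "integrable lborel (\<lambda>t. f (t *\<^sub>R u))"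
    using assms(6) by (intro integrableI_nonneg) auto
  have "ennreal ((2 * pi) ^ (DIM('a) - 1) * (LINT t|lborel. f (t *\<^sub>R u)))
      = ennreal (Gamma (1 + (real DIM('a) - 1) / \<alpha>) * measure ?W (F \<inter> {u}\<^sup>\<bottom>))"
    using main assms(6) by (simp add: nn_integral_eq_integral[OF int] ennreal_mult)
  then have "(2 * pi) ^ (DIM('a) - 1) * (LINT t|lborel. f (t *\<^sub>R u))
      = Gamma (1 + (real DIM('a) - 1) / \<alpha>) * measure ?W (F \<inter> {u}\<^sup>\<bottom>)"
    using Gamma_nonneg assms(6) by (subst (asm) ennreal_inj) simp_all
  then show ?thesis
    using fm int by (simp add: field_simps)
qed

end
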